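(* Let $\lambda\in\mathbb{R}^+$ and consider the process $X_t\in\mathbb{R}$, $t\in[0,T]$, given by $$dX_t=\left[\sqrt{2\lambda}\,\tanh\!\big(\sqrt{2\lambda}\,X_t\big)\right]dt+dW_t,$$ where $W_t$ is the standard Brownian motion. This process, started at $x_0$ at time $0$, obeys the following transition probability density: $$Q(x,t\,|\,x_0,0)=\frac{1}{2\sqrt{2\pi t}}\left\{e^{-\frac{(x-x_0-\sqrt{2\lambda}\,t)^2}{2t}}+e^{-\frac{(x-x_0+\sqrt{2\lambda}\,t)^2}{2t}}\right\},$$ which is a superposition of two $\pm\sqrt{2\lambda}$-drifted Wiener processes. This implies that the equation for $X_t$ can be rewritten as $$dX_t=\mathcal{B}\,dt+dW_t,$$ where $\mathcal{B}$ stands for a Bernoulli random variable taking the values $\pm\sqrt{2\lambda}$ with probability $0.5$.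
   Context: $Q(x,t\,|\,x_0,0)$ denotes the transition probability density of the process $X_t$, i.e. the density at $x$ of $X_t$ given $X_0=x_0$; it solves the Kolmogorov forward equation $\partial_t Q=-\partial_x\big[\sqrt{2\lambda}\tanh(\sqrt{2\lambda}\,x)\,Q\big]+\tfrac12\partial_{xx}Q$. The rewritten equation is to be understood as a process in which one observes the realization of the sign of the drift and afterwards lets the process behave according to the resulting $\pm\sqrt{2\lambda}$-drifted Brownian motion.
   Formalization: The density Q of X_t and the rewriting with probability 0.5 fail for x_0≠0 (Q has mean x_0, the process does not); they are proved for x_0=0, and for general x_0 with weights (1±tanh(√(2λ)x_0))/2 instead of 1/2. "Rewritten" means equality of path laws. *)

theory Defs
  imports "HOL-Probability.Probability"
begin

text \<open>Standard Brownian motion on \<open>[0,T]\<close> with respect to a filtration. Only the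
  \<open>\<sigma>\<close>-algebras \<open>F t\<close> with \<open>t \<in> {0..T}\<close> matter.\<close>

definition brownian_motion ::
  "'a measure \<Rightarrow> (real \<Rightarrow> 'a measure) \<Rightarrow> real \<Rightarrow> (real \<Rightarrow> 'a \<Rightarrow> real) \<Rightarrow> bool" where
  "brownian_motion M F T W \<longleftrightarrow>
     prob_space M \<and> filtration (space M) F \<and>
     (\<forall>t\<in>{0..T}. subalgebra M (F t) \<and> W t \<in> borel_measurable (F t)) \<and>
     (AE \<omega> in M. W 0 \<omega> = 0) \<and>
     (AE \<omega> in M. continuous_on {0..T} (\<lambda>t. W t \<omega>)) \<and>
     (\<forall>s\<in>{0..T}. \<forall>t\<in>{s<..T}.
        prob_space.indep_set M (sets (F s))
          {(\<lambda>\<omega>. W t \<omega> - W s \<omega>) -` A \<inter> space M | A. A \<in> sets borel} \<and>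
        distributed M lborel (\<lambda>\<omega>. W t \<omega> - W s \<omega>) (normal_density 0 (sqrt (t - s))))"

text \<open>\<open>X\<close> is an adapted continuous solution on \<open>[0,T]\<close> of \<open>dX\<^sub>t = b(X\<^sub>t) dt + dW\<^sub>t\<close>, \<open>X\<^sub>0 = x0\<close>. The
  noise is additive, so the equation is the pathwise integral equation
  \<open>X\<^sub>t = x0 + \<integral>\<^sub>0\<^sup>t b(X\<^sub>s) ds + W\<^sub>t\<close> and no stochastic integral is involved. The drift may also
  depend on the sample point, which covers a drift that is itself a random variable.\<close>

definition sde_solution ::
  "'a measure \<Rightarrow> (real \<Rightarrow> 'a measure) \<Rightarrow> real \<Rightarrow> real \<Rightarrow> (real \<Rightarrow> 'a \<Rightarrow> real)
     \<Rightarrow> (real \<Rightarrow> 'a \<Rightarrow> real) \<Rightarrow> (real \<Rightarrow> 'a \<Rightarrow> real) \<Rightarrow> bool" where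
  "sde_solution M F T x0 b W X \<longleftrightarrow>
     brownian_motion M F T W \<and>
     (\<forall>t\<in>{0..T}. X t \<in> borel_measurable (F t)) \<and>
     (AE \<omega> in M. continuous_on {0..T} (\<lambda>t. X t \<omega>)) \<and>
     (AE \<omega> in M. \<forall>t\<in>{0..T}.
        ((\<lambda>s. b (X s \<omega>) \<omega>) has_integral (X t \<omega> - x0 - W t \<omega>)) {0..t})"

text \<open>\<open>Y\<close> solves \<open>dY\<^sub>t = B dt + dV\<^sub>t\<close>, \<open>Y\<^sub>0 = x0\<close>, where \<open>B\<close> takes the value \<open>c\<close> with probability
  \<open>p\<close> and \<open>- c\<close> with probability \<open>1 - p\<close>. Measurability with respect to \<open>G 0\<close> says that the sign
  is observed first; it makes \<open>B\<close> independent of the Brownian motion \<open>V\<close>.\<close>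

definition bernoulli_drift_solution ::
  "'a measure \<Rightarrow> (real \<Rightarrow> 'a measure) \<Rightarrow> real \<Rightarrow> real \<Rightarrow> real \<Rightarrow> real \<Rightarrow> ('a \<Rightarrow> real)
     \<Rightarrow> (real \<Rightarrow> 'a \<Rightarrow> real) \<Rightarrow> (real \<Rightarrow> 'a \<Rightarrow> real) \<Rightarrow> bool" where
  "bernoulli_drift_solution N G T x0 c p B V Y \<longleftrightarrow>
     B \<in> borel_measurable (G 0) \<and>
     distr N borel B = distr (measure_pmf (bernoulli_pmf p)) borel (\<lambda>h. if h then c else - c) \<and>
     sde_solution N G T x0 (\<lambda>_ \<omega>. B \<omega>) V Y"

text \<open>Law of a process on the path space \<open>\<real>\<^bsup>[0,T]\<^esup>\<close>; equality of two such laws is equality of all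
  finite-dimensional distributions.\<close>

definition path_law :: "'a measure \<Rightarrow> real \<Rightarrow> (real \<Rightarrow> 'a \<Rightarrow> real) \<Rightarrow> (real \<Rightarrow> real) measure" where
  "path_law M T X = distr M (\<Pi>\<^sub>M t\<in>{0..T}. borel) (\<lambda>\<omega>. \<lambda>t\<in>{0..T}. X t \<omega>)"

definition Q_density :: "real \<Rightarrow> real \<Rightarrow> real \<Rightarrow> real \<Rightarrow> real" where
  "Q_density lam x0 t x =
     1 / (2 * sqrt (2 * pi * t)) *
       (exp (- ((x - x0 - sqrt (2 * lam) * t)\<^sup>2 / (2 * t))) +
        exp (- ((x - x0 + sqrt (2 * lam) * t)\<^sup>2 / (2 * t))))"

end

theory Submission
  imports Defs
begin

text \<open>
  Observe a Brownian motion with unknown drift \<open>\<plusminus>c\<close>, the sign being drawn beforehand. Given the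
  observation up to time \<open>t\<close>, the posterior probability of the drift \<open>a = \<plusminus>c\<close> depends on the current
  position only and is \<open>q\<^sub>a(x) = (1 + tanh (a x)) / 2\<close>, if it is \<open>q\<^sub>a(x0)\<close> at time \<open>0\<close>; the mean drift
  under the posterior is \<open>c tanh (c x)\<close>. This is why the diffusion with that drift has the law of
  the process with a random sign, and why the prior weights must be \<open>q\<^sub>a(x0)\<close>, which are equal
  exactly for \<open>x0 = 0\<close>.

  The proof reads this backwards, starting from the diffusion \<open>X\<close>. The function \<open>q\<^sub>a\<close> is harmonic
  for the generator of \<open>X\<close>, so \<open>q\<^sub>a(X\<^sub>t)\<close> is a martingale, and under the measure with density
  \<open>q\<^sub>a(X\<^sub>T) / q\<^sub>a(x0)\<close> the process \<open>X\<^sub>t - x0 - a t\<close> is a Brownian motion (\<open>brownian_tilted\<close>). As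
  \<open>q\<^sub>c + q\<^sub>-\<^sub>c = 1\<close>, the original measure is the mixture of the two tilted ones with weights
  \<open>q\<^sub>a(x0)\<close> (\<open>emeasure_mixture\<close>). On the other side, conditioning the process with a random sign on
  that sign leaves its noise a Brownian motion (\<open>brownian_uniform_measure\<close>). Both processes are
  thus mixtures, with the same weights, of Brownian motions with drift \<open>\<plusminus>c\<close>, and the
  finite-dimensional distributions of Brownian motion are unique (\<open>brownian_fidi_unique\<close>). The
  one-dimensional marginals of the mixture give the density.

  The change of measure is proved by elementary means. By uniqueness of characteristic
  functions it suffices that \<open>exp (\<theta>\<^sup>2 r / 2) cos (\<theta> (x - a r) + \<phi>) q\<^sub>a(x)\<close> yields martingales along
  \<open>X\<close>. These functions solve the backward equation (\<open>wave_backward_equation\<close>) and are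
  bounded with bounded derivatives. For such functions the martingale property
  (\<open>backward_solution_martingale\<close>) follows from a second-order Taylor expansion over a fine grid:
  the noise is additive, hence \<open>X - W\<close> is differentiable along almost every path, the first two
  moments of the Brownian increments cancel the leading terms, and the remainders add up to
  something that vanishes with the mesh.
\<close>

section \<open>Brownian motion and its finite-dimensional distributions\<close>

text \<open>Changes of measure turn one Brownian motion into another on the same filtered space, so
  the probability measure is a parameter of the locale.\<close>

locale brownian =
  fixes M :: "'a measure" and F :: "real \<Rightarrow> 'a measure" and T :: real
    and W :: "real \<Rightarrow> 'a \<Rightarrow> real"
  assumes brownian_motion: "brownian_motion M F T W"
    and horizon_nonneg: "0 \<le> T"
begin

sublocale prob_space M
  using brownian_motion by (simp add: brownian_motion_def)

lemma space_F: "space (F t) = space M"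
  using brownian_motion by (simp add: brownian_motion_def filtration_def)

lemma sets_F_mono: "s \<le> t \<Longrightarrow> sets (F s) \<subseteq> sets (F t)"
  using brownian_motion by (simp add: brownian_motion_def filtration_def)

lemma sets_F_le: "t \<in> {0..T} \<Longrightarrow> sets (F t) \<subseteq> sets M"
  using brownian_motion by (auto simp add: brownian_motion_def subalgebra_def)

lemma measurable_F_mono: "f \<in> measurable (F s) N \<Longrightarrow> s \<le> t \<Longrightarrow> f \<in> measurable (F t) N"
  using measurable_mono[OF order_refl refl sets_F_mono] space_F by fastforce

lemma measurable_F_M: "f \<in> measurable (F s) N \<Longrightarrow> s \<in> {0..T} \<Longrightarrow> f \<in> measurable M N"
  using measurable_mono[OF order_refl refl sets_F_le] space_F by fastforce

lemma W_adapted: "t \<in> {0..T} \<Longrightarrow> W t \<in> borel_measurable (F t)"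
  using brownian_motion by (simp add: brownian_motion_def)

lemma W_measurable: "t \<in> {0..T} \<Longrightarrow> W t \<in> borel_measurable M"
  using W_adapted measurable_F_M by blast

lemma W_start: "AE \<omega> in M. W 0 \<omega> = 0"
  using brownian_motion by (simp add: brownian_motion_def)

lemma increment_distributed:
  "s \<in> {0..T} \<Longrightarrow> t \<in> {s<..T} \<Longrightarrow>
    distributed M lborel (\<lambda>\<omega>. W t \<omega> - W s \<omega>) (normal_density 0 (sqrt (t - s)))"
  using brownian_motion by (simp add: brownian_motion_def)

lemma increment_indep_set:
  "s \<in> {0..T} \<Longrightarrow> t \<in> {s<..T} \<Longrightarrow>
    indep_set (sets (F s)) {(\<lambda>\<omega>. W t \<omega> - W s \<omega>) -` A \<inter> space M | A. A \<in> sets borel}"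
  using brownian_motion by (simp add: brownian_motion_def)

lemma increment_law:
  assumes s: "s \<in> {0..T}" and t: "t \<in> {s<..T}"
  shows "distr M borel (\<lambda>\<omega>. W t \<omega> - W s \<omega>) = density lborel (normal_density 0 (sqrt (t - s)))"
proof -
  have "distr M borel (\<lambda>\<omega>. W t \<omega> - W s \<omega>) = distr M lborel (\<lambda>\<omega>. W t \<omega> - W s \<omega>)"
    by (rule distr_cong) auto
  then show ?thesis
    using distributed_distr_eq_density[OF increment_distributed[OF s t]] by simp
qed

text \<open>Independence of the whole \<open>\<sigma>\<close>-algebra \<open>F s\<close> from the increment allows the increment
  to be integrated out first, with the past frozen. The identity map is the random variable with
  values in the coarser space \<open>F s\<close>, which makes this an instance of Tonelli's theorem.\<close>

lemma increment_joint_law: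
  assumes s: "s \<in> {0..T}" and t: "t \<in> {s<..T}"
    and h[measurable]: "h \<in> borel_measurable (F s \<Otimes>\<^sub>M borel)"
  shows "(\<integral>\<^sup>+\<omega>. h (\<omega>, W t \<omega> - W s \<omega>) \<partial>M) =
    (\<integral>\<^sup>+\<omega>. (\<integral>\<^sup>+z. h (\<omega>, z) \<partial>density lborel (normal_density 0 (sqrt (t - s)))) \<partial>M)"
proof -
  let ?N = "density lborel (normal_density 0 (sqrt (t - s)))"
  let ?D = "distr M (F s) (\<lambda>\<omega>. \<omega>)"
  have [measurable]: "W t \<in> borel_measurable M" "W s \<in> borel_measurable M"
    using W_measurable s t by auto
  have id[measurable]: "(\<lambda>\<omega>. \<omega>) \<in> measurable M (F s)"
    using measurable_F_M[OF measurable_ident_sets[OF refl] s] .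
  note law = increment_law[OF s t]
  interpret N: prob_space ?N
    using t by (intro prob_space_normal_density) simp
  interpret D: prob_space ?D
    by (rule prob_space_distr) (rule id)
  have prod: "?D \<Otimes>\<^sub>M ?N = distr M (F s \<Otimes>\<^sub>M borel) (\<lambda>\<omega>. (\<omega>, W t \<omega> - W s \<omega>))"
  proof (rule pair_measure_eqI)
    show "sigma_finite_measure ?D" "sigma_finite_measure ?N" by unfold_locales
    show "sets (?D \<Otimes>\<^sub>M ?N) = sets (distr M (F s \<Otimes>\<^sub>M borel) (\<lambda>\<omega>. (\<omega>, W t \<omega> - W s \<omega>)))"
      by (simp cong: sets_pair_measure_cong)
    fix A B assume "A \<in> sets ?D" "B \<in> sets ?N"
    then have A: "A \<in> sets (F s)" and B[measurable]: "B \<in> sets borel" by auto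
    have AM: "A \<in> sets M" using A sets_F_le[OF s] by auto
    then have sub: "A \<subseteq> space M" by (rule sets.sets_into_space)
    let ?E = "(\<lambda>\<omega>. W t \<omega> - W s \<omega>) -` B \<inter> space M"
    have "emeasure ?N B = emeasure M ?E"
      unfolding law[symmetric] by (rule emeasure_distr) auto
    moreover have "emeasure ?D A = emeasure M A"
      using A sub by (subst emeasure_distr[OF id]) (auto simp: Int_absorb2)
    moreover have "emeasure (distr M (F s \<Otimes>\<^sub>M borel) (\<lambda>\<omega>. (\<omega>, W t \<omega> - W s \<omega>))) (A \<times> B)
      = emeasure M (A \<inter> ?E)"
      using A sub by (subst emeasure_distr) (auto intro!: arg_cong2[where f=emeasure])
    moreover have "prob (A \<inter> ?E) = prob A * prob ?E"
      using A B by (intro indep_setD[OF increment_indep_set[OF s t]]) auto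
    ultimately show "emeasure ?D A * emeasure ?N B =
        emeasure (distr M (F s \<Otimes>\<^sub>M borel) (\<lambda>\<omega>. (\<omega>, W t \<omega> - W s \<omega>))) (A \<times> B)"
      by (simp add: emeasure_eq_measure ennreal_mult)
  qed
  have "(\<integral>\<^sup>+\<omega>. h (\<omega>, W t \<omega> - W s \<omega>) \<partial>M)
      = (\<integral>\<^sup>+x. h x \<partial>distr M (F s \<Otimes>\<^sub>M borel) (\<lambda>\<omega>. (\<omega>, W t \<omega> - W s \<omega>)))"
    by (subst nn_integral_distr) auto
  also have "\<dots> = (\<integral>\<^sup>+x. h x \<partial>(?D \<Otimes>\<^sub>M ?N))"
    by (simp only: prod)
  also have "\<dots> = (\<integral>\<^sup>+\<omega>. (\<integral>\<^sup>+z. h (\<omega>, z) \<partial>?N) \<partial>?D)"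
    by (rule N.nn_integral_fst[symmetric]) (simp add: h cong: measurable_cong_sets sets_pair_measure_cong)
  also have "\<dots> = (\<integral>\<^sup>+\<omega>. (\<integral>\<^sup>+z. h (\<omega>, z) \<partial>?N) \<partial>M)"
    by (subst nn_integral_distr) auto
  finally show ?thesis .
qed

lemma increment_fubini:
  assumes s: "s \<in> {0..T}" and t: "t \<in> {s<..T}"
    and Z[measurable]: "Z \<in> borel_measurable (F s)" and f[measurable]: "f \<in> borel_measurable borel"
  shows "(\<integral>\<^sup>+\<omega>. Z \<omega> * f (W t \<omega>) \<partial>M) =
    (\<integral>\<^sup>+\<omega>. Z \<omega> * (\<integral>\<^sup>+z. f (W s \<omega> + z) \<partial>density lborel (normal_density 0 (sqrt (t - s)))) \<partial>M)"
proof -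
  have [measurable]: "W s \<in> borel_measurable (F s)"
    using W_adapted s by auto
  show ?thesis
    using increment_joint_law[OF s t, of "\<lambda>(\<omega>, z). Z \<omega> * f (W s \<omega> + z)"]
    by (simp add: nn_integral_cmult)
qed

lemma start_law:
  assumes "\<And>j. f j \<in> borel_measurable borel"
  shows "(\<integral>\<^sup>+\<omega>. (\<Prod>j\<in>{0::real}. f j (W j \<omega>)) \<partial>M) = f 0 (0::real)"
proof -
  have "(\<integral>\<^sup>+\<omega>. (\<Prod>j\<in>{0::real}. f j (W j \<omega>)) \<partial>M) = (\<integral>\<^sup>+\<omega>. f 0 0 \<partial>M)"
    using W_start by (intro nn_integral_cong_AE) auto
  then show ?thesis by (simp add: emeasure_space_1)
qed

text \<open>Integrating out the last increment of a cylinder functional leaves a functional of the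
  earlier times: the Gaussian average \<open>g\<close> of the last factor depends only on the position at the
  preceding time and is absorbed into the factor there.\<close>

lemma fidi_step:
  fixes f :: "real \<Rightarrow> real \<Rightarrow> ennreal"
  assumes J: "finite J" "J \<subseteq> {0..T}" "J \<noteq> {}" and t: "t \<in> {Max J<..T}"
    and f[measurable]: "\<And>j. f j \<in> borel_measurable borel"
  defines "g \<equiv> (\<lambda>x. \<integral>\<^sup>+z. f t (x + z) \<partial>density lborel (normal_density 0 (sqrt (t - Max J))))"
  shows "(\<integral>\<^sup>+\<omega>. (\<Prod>j\<in>insert t J. f j (W j \<omega>)) \<partial>M) =
    (\<integral>\<^sup>+\<omega>. (\<Prod>j\<in>J. (f(Max J := \<lambda>x. f (Max J) x * g x)) j (W j \<omega>)) \<partial>M)"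
proof -
  let ?s = "Max J"
  have s: "?s \<in> J" using J by simp
  have s0: "?s \<in> {0..T}" using subsetD[OF J(2) s] .
  have tJ: "t \<notin> J" using t J Max_ge[of J t] by auto
  have [measurable]: "W j \<in> borel_measurable (F ?s)" if "j \<in> J" for j
    using measurable_F_mono[OF W_adapted] that J Max_ge by blast
  have "(\<integral>\<^sup>+\<omega>. (\<Prod>j\<in>insert t J. f j (W j \<omega>)) \<partial>M) =
     (\<integral>\<^sup>+\<omega>. (\<Prod>j\<in>J. f j (W j \<omega>)) * f t (W t \<omega>) \<partial>M)"
    using J tJ by (simp add: mult.commute)
  also have "\<dots> = (\<integral>\<^sup>+\<omega>. (\<Prod>j\<in>J. f j (W j \<omega>)) * g (W ?s \<omega>) \<partial>M)"
    unfolding g_def by (rule increment_fubini[OF s0 t]) measurable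
  also have "\<dots> = (\<integral>\<^sup>+\<omega>. (\<Prod>j\<in>J. (f(?s := \<lambda>x. f ?s x * g x)) j (W j \<omega>)) \<partial>M)"
  proof (rule nn_integral_cong)
    fix \<omega>
    have "(\<Prod>j\<in>J. (f(?s := \<lambda>x. f ?s x * g x)) j (W j \<omega>))
       = f ?s (W ?s \<omega>) * g (W ?s \<omega>) * (\<Prod>j\<in>J - {?s}. f j (W j \<omega>))"
      using J s by (subst prod.remove[of J ?s]) auto
    moreover have "(\<Prod>j\<in>J. f j (W j \<omega>)) = f ?s (W ?s \<omega>) * (\<Prod>j\<in>J - {?s}. f j (W j \<omega>))"
      using J s by (subst prod.remove[of J ?s]) auto
    ultimately show "(\<Prod>j\<in>J. f j (W j \<omega>)) * g (W ?s \<omega>)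
       = (\<Prod>j\<in>J. (f(?s := \<lambda>x. f ?s x * g x)) j (W j \<omega>))"
      by (simp add: mult_ac)
  qed
  finally show ?thesis .
qed

end

text \<open>Since \<open>fidi_step\<close> produces the same reduced factors for every Brownian motion, induction
  on the latest time brings both sides down to time \<open>0\<close>, where both motions sit at the origin.
  Time \<open>0\<close> is kept in the index set to give the first increment a starting point.\<close>

lemma brownian_fidi_unique_insert:
  fixes f :: "real \<Rightarrow> real \<Rightarrow> ennreal"
  assumes M: "brownian M F T W" and N: "brownian N G T V"
    and J: "finite J" "J \<subseteq> {0<..T}"
    and f: "\<And>j. f j \<in> borel_measurable borel"
  shows "(\<integral>\<^sup>+\<omega>. (\<Prod>j\<in>insert 0 J. f j (W j \<omega>)) \<partial>M) = (\<integral>\<^sup>+\<omega>. (\<Prod>j\<in>insert 0 J. f j (V j \<omega>)) \<partial>N)"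
  using J f
proof (induction J arbitrary: f rule: finite_linorder_max_induct)
  case empty
  then show ?case using brownian.start_law[OF M] brownian.start_law[OF N] by simp
next
  case (insert t J)
  note [measurable] = insert.prems(2)
  let ?J = "insert 0 J" let ?s = "Max ?J"
  let ?g = "\<lambda>x. \<integral>\<^sup>+z. f t (x + z) \<partial>density lborel (normal_density 0 (sqrt (t - ?s)))"
  let ?f = "f(?s := \<lambda>x. f ?s x * ?g x)"
  have J: "finite ?J" "?J \<subseteq> {0..T}" "?J \<noteq> {}" "t \<in> {?s<..T}"
    using insert brownian.horizon_nonneg[OF M] by auto
  interpret NN: sigma_finite_measure "density lborel (normal_density 0 (sqrt (t - ?s)))"
    using J(4) by (intro prob_space_imp_sigma_finite prob_space_normal_density) simp
  have meas: "?f j \<in> borel_measurable borel" for j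
    by (cases "j = ?s") auto
  have "(\<integral>\<^sup>+\<omega>. (\<Prod>j\<in>insert t ?J. f j (W j \<omega>)) \<partial>M) = (\<integral>\<^sup>+\<omega>. (\<Prod>j\<in>?J. ?f j (W j \<omega>)) \<partial>M)"
    by (rule brownian.fidi_step[OF M J insert.prems(2)])
  also have "\<dots> = (\<integral>\<^sup>+\<omega>. (\<Prod>j\<in>?J. ?f j (V j \<omega>)) \<partial>N)"
    using insert.prems(1) by (intro insert.IH meas) auto
  also have "\<dots> = (\<integral>\<^sup>+\<omega>. (\<Prod>j\<in>insert t ?J. f j (V j \<omega>)) \<partial>N)"
    by (rule brownian.fidi_step[OF N J insert.prems(2), symmetric])
  finally show ?case by (simp add: insert_commute)
qed

lemma brownian_fidi_unique:
  fixes f :: "real \<Rightarrow> real \<Rightarrow> ennreal"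
  assumes M: "brownian M F T W" and N: "brownian N G T V"
    and J: "finite J" "J \<subseteq> {0..T}"
    and f: "\<And>j. f j \<in> borel_measurable borel"
  shows "(\<integral>\<^sup>+\<omega>. (\<Prod>j\<in>J. f j (W j \<omega>)) \<partial>M) = (\<integral>\<^sup>+\<omega>. (\<Prod>j\<in>J. f j (V j \<omega>)) \<partial>N)"
proof -
  \<comment> \<open>Time \<open>0\<close> is added, if necessary, with the trivial factor \<open>1\<close>.\<close>
  let ?f = "\<lambda>j. if j \<in> J then f j else (\<lambda>_. 1)"
  have *: "(\<Prod>j\<in>insert 0 (J - {0}). ?f j (U j)) = (\<Prod>j\<in>J. f j (U j))" for U :: "real \<Rightarrow> real"
    using J(1) by (intro prod.mono_neutral_cong_right) auto
  have "J - {0} \<subseteq> {0<..T}" using J(2) by (auto simp: less_eq_real_def)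
  then show ?thesis
    using brownian_fidi_unique_insert[OF M N, of "J - {0}" ?f] J(1) f unfolding * by simp
qed

text \<open>Increments are independent of every \<open>F s\<close>, hence of an event that is already decided at
  time \<open>0\<close>. This is how the Bernoulli drift is handled: given the sign, the noise is still a
  Brownian motion.\<close>

lemma (in brownian) brownian_uniform_measure:
  assumes E: "E \<in> sets (F 0)" and pos: "prob E \<noteq> 0"
  shows "brownian (uniform_measure M E) F T W"
proof -
  have EM[measurable]: "E \<in> sets M" using sets_F_le[of 0] horizon_nonneg E by auto
  let ?U = "uniform_measure M E"
  have e: "emeasure M E \<noteq> 0" "emeasure M E < \<infinity>" "emeasure M E \<noteq> \<infinity>"
    using pos by (auto simp: emeasure_eq_measure)
  interpret U: prob_space ?U
    using e by (intro prob_space_uniform_measure) auto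
  have AEU: "AE x in ?U. P x" if "AE x in M. P x" for P
    using e that by (subst AE_uniform_measure) auto
  have incr: "prob_space.indep_set ?U (sets (F s))
          {(\<lambda>\<omega>. W t \<omega> - W s \<omega>) -` A \<inter> space ?U | A. A \<in> sets borel} \<and>
        distributed ?U lborel (\<lambda>\<omega>. W t \<omega> - W s \<omega>) (normal_density 0 (sqrt (t - s)))"
    if s: "s \<in> {0..T}" and t: "t \<in> {s<..T}" for s t
  proof -
    have [measurable]: "W t \<in> borel_measurable M" "W s \<in> borel_measurable M"
      using W_measurable s t by auto
    let ?D = "\<lambda>A. (\<lambda>\<omega>. W t \<omega> - W s \<omega>) -` A \<inter> space M"
    have EF: "E \<in> sets (F s)" using E sets_F_mono[of 0 s] s by auto
    have D[measurable]: "?D A \<in> sets M" if "A \<in> sets borel" for A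
      using that by measurable
    have key: "U.prob (H \<inter> ?D A) = U.prob H * prob (?D A)"
      if H: "H \<in> sets (F s)" and A: "A \<in> sets borel" for H A
    proof -
      have HM[measurable]: "H \<in> sets M" using H sets_F_le s by auto
      have "prob ((E \<inter> H) \<inter> ?D A) = prob (E \<inter> H) * prob (?D A)"
        using indep_setD[OF increment_indep_set[OF s t], of "E \<inter> H" "?D A"] H EF A by auto
      then show ?thesis
        using e D[OF A] by (simp add: measure_uniform_measure Int_assoc)
    qed
    have D1: "U.prob (?D A) = prob (?D A)" if A: "A \<in> sets borel" for A
      using key[OF sets.top A] U.prob_space by (simp add: space_F Int_assoc[symmetric] Int_commute)
    have "U.indep_set (sets (F s)) {?D A | A. A \<in> sets borel}"
      using sets_F_le[OF s] D by (intro U.indep_setI) (auto simp: key D1)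
    moreover have "distr ?U lborel (\<lambda>\<omega>. W t \<omega> - W s \<omega>) = distr M lborel (\<lambda>\<omega>. W t \<omega> - W s \<omega>)"
      using D1 by (intro measure_eqI)
        (auto simp: emeasure_distr emeasure_eq_measure U.emeasure_eq_measure simp del: emeasure_uniform_measure)
    ultimately show ?thesis
      using increment_distributed[OF s t] by (auto simp: distributed_def)
  qed
  show ?thesis
  proof
    show "brownian_motion ?U F T W"
      unfolding brownian_motion_def
      using U.prob_space_axioms brownian_motion incr AEU
      by (auto simp: brownian_motion_def subalgebra_def)
  qed (fact horizon_nonneg)
qed

section \<open>A pathwise Taylor expansion on the diffusive scale\<close>

text \<open>One constant \<open>K\<close> serves as bound and as joint Lipschitz constant on the strip
  \<open>[0,T] \<times> \<real>\<close>. The class is closed under sums and products, so the remainder estimates below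
  apply to all functions built from \<open>exp\<close>, \<open>cos\<close>, \<open>sin\<close> and \<open>tanh\<close> without computing constants.\<close>

definition bdd_lipschitz :: "real \<Rightarrow> (real \<Rightarrow> real \<Rightarrow> real) \<Rightarrow> bool" where
  "bdd_lipschitz T f \<longleftrightarrow> (\<exists>K\<ge>0. \<forall>r\<in>{0..T}. \<forall>x. \<bar>f r x\<bar> \<le> K \<and>
     (\<forall>r'\<in>{0..T}. \<forall>x'. \<bar>f r x - f r' x'\<bar> \<le> K * (\<bar>r - r'\<bar> + \<bar>x - x'\<bar>)))"

lemma bdd_lipschitzI:
  assumes "0 \<le> B" "0 \<le> L"
    and "\<And>r x. r \<in> {0..T} \<Longrightarrow> \<bar>f r x\<bar> \<le> B"
    and "\<And>r x r' x'. r \<in> {0..T} \<Longrightarrow> r' \<in> {0..T} \<Longrightarrow>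
      \<bar>f r x - f r' x'\<bar> \<le> L * (\<bar>r - r'\<bar> + \<bar>x - x'\<bar>)"
  shows "bdd_lipschitz T f"
  unfolding bdd_lipschitz_def
proof (intro exI[of _ "B + L"] conjI ballI allI)
  fix r x assume r: "r \<in> {0..T}"
  show "\<bar>f r x\<bar> \<le> B + L" using assms(2) assms(3)[OF r, of x] by linarith
  fix r' x' assume r': "r' \<in> {0..T}"
  have "L * (\<bar>r - r'\<bar> + \<bar>x - x'\<bar>) \<le> (B + L) * (\<bar>r - r'\<bar> + \<bar>x - x'\<bar>)"
    using assms(1) by (intro mult_right_mono) auto
  with assms(4)[OF r r', of x x'] show "\<bar>f r x - f r' x'\<bar> \<le> (B + L) * (\<bar>r - r'\<bar> + \<bar>x - x'\<bar>)"
    by linarith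
qed (use assms in auto)

lemma bdd_lipschitzE:
  assumes "bdd_lipschitz T f"
  obtains K where "0 \<le> K" "\<And>r x. r \<in> {0..T} \<Longrightarrow> \<bar>f r x\<bar> \<le> K"
    "\<And>r x r' x'. r \<in> {0..T} \<Longrightarrow> r' \<in> {0..T} \<Longrightarrow>
      \<bar>f r x - f r' x'\<bar> \<le> K * (\<bar>r - r'\<bar> + \<bar>x - x'\<bar>)"
  using assms unfolding bdd_lipschitz_def by blast

lemma bdd_lipschitz_const: "bdd_lipschitz T (\<lambda>r x. k)"
  by (rule bdd_lipschitzI[of "\<bar>k\<bar>" 0]) auto

lemma bdd_lipschitz_add:
  assumes "bdd_lipschitz T f" "bdd_lipschitz T g"
  shows "bdd_lipschitz T (\<lambda>r x. f r x + g r x)"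
proof -
  obtain K where K: "0 \<le> K" "\<And>r x. r \<in> {0..T} \<Longrightarrow> \<bar>f r x\<bar> \<le> K"
    "\<And>r x r' x'. r \<in> {0..T} \<Longrightarrow> r' \<in> {0..T} \<Longrightarrow>
      \<bar>f r x - f r' x'\<bar> \<le> K * (\<bar>r - r'\<bar> + \<bar>x - x'\<bar>)"
    using bdd_lipschitzE[OF assms(1)] by blast
  obtain L where L: "0 \<le> L" "\<And>r x. r \<in> {0..T} \<Longrightarrow> \<bar>g r x\<bar> \<le> L"
    "\<And>r x r' x'. r \<in> {0..T} \<Longrightarrow> r' \<in> {0..T} \<Longrightarrow>
      \<bar>g r x - g r' x'\<bar> \<le> L * (\<bar>r - r'\<bar> + \<bar>x - x'\<bar>)"
    using bdd_lipschitzE[OF assms(2)] by blast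
  show ?thesis
  proof (rule bdd_lipschitzI[of "K + L" "K + L"])
    fix r x r' x' assume r: "r \<in> {0..T}" "r' \<in> {0..T}"
    show "\<bar>f r x + g r x - (f r' x' + g r' x')\<bar> \<le> (K + L) * (\<bar>r - r'\<bar> + \<bar>x - x'\<bar>)"
      using K(3)[OF r, of x x'] L(3)[OF r, of x x'] unfolding distrib_right[of K L] by linarith
  next
    fix r x assume r: "r \<in> {0..T}"
    show "\<bar>f r x + g r x\<bar> \<le> K + L"
      using K(2)[OF r, of x] L(2)[OF r, of x] by linarith
  qed (use K L in auto)
qed

lemma bdd_lipschitz_mult:
  assumes "bdd_lipschitz T f" "bdd_lipschitz T g"
  shows "bdd_lipschitz T (\<lambda>r x. f r x * g r x)"
proof -
  obtain K where K: "0 \<le> K" "\<And>r x. r \<in> {0..T} \<Longrightarrow> \<bar>f r x\<bar> \<le> K"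
    "\<And>r x r' x'. r \<in> {0..T} \<Longrightarrow> r' \<in> {0..T} \<Longrightarrow>
      \<bar>f r x - f r' x'\<bar> \<le> K * (\<bar>r - r'\<bar> + \<bar>x - x'\<bar>)"
    using bdd_lipschitzE[OF assms(1)] by blast
  obtain L where L: "0 \<le> L" "\<And>r x. r \<in> {0..T} \<Longrightarrow> \<bar>g r x\<bar> \<le> L"
    "\<And>r x r' x'. r \<in> {0..T} \<Longrightarrow> r' \<in> {0..T} \<Longrightarrow>
      \<bar>g r x - g r' x'\<bar> \<le> L * (\<bar>r - r'\<bar> + \<bar>x - x'\<bar>)"
    using bdd_lipschitzE[OF assms(2)] by blast
  show ?thesis
  proof (rule bdd_lipschitzI[of "K * L" "2 * K * L"])
    fix r x assume r: "r \<in> {0..T}"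
    show "\<bar>f r x * g r x\<bar> \<le> K * L"
      using K(2)[OF r, of x] L(2)[OF r, of x] K(1) by (auto simp: abs_mult intro: mult_mono)
  next
    fix r x r' x' assume r: "r \<in> {0..T}" "r' \<in> {0..T}"
    let ?d = "\<bar>r - r'\<bar> + \<bar>x - x'\<bar>"
    have "f r x * g r x - f r' x' * g r' x' = f r x * (g r x - g r' x') + g r' x' * (f r x - f r' x')"
      by (simp add: algebra_simps)
    then have "\<bar>f r x * g r x - f r' x' * g r' x'\<bar>
        \<le> \<bar>f r x\<bar> * \<bar>g r x - g r' x'\<bar> + \<bar>g r' x'\<bar> * \<bar>f r x - f r' x'\<bar>"
      by (metis abs_mult abs_triangle_ineq)
    also have "\<dots> \<le> K * (L * ?d) + L * (K * ?d)"
      using K L r by (intro add_mono mult_mono) auto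
    finally show "\<bar>f r x * g r x - f r' x' * g r' x'\<bar> \<le> 2 * K * L * ?d"
      by (simp add: algebra_simps)
  qed (use K L in auto)
qed

lemma bdd_lipschitz_affine:
  fixes f :: "real \<Rightarrow> real"
  assumes f: "\<And>u. (f has_real_derivative f' u) (at u)" "\<And>u. \<bar>f' u\<bar> \<le> L" "\<And>u. \<bar>f u\<bar> \<le> B"
  shows "bdd_lipschitz T (\<lambda>r x. f (\<alpha> * r + \<beta> * x + \<gamma>))"
proof (rule bdd_lipschitzI[of B "L * (\<bar>\<alpha>\<bar> + \<bar>\<beta>\<bar>)"])
  have L: "0 \<le> L" using f(2)[of 0] by linarith
  show "0 \<le> B" using f(3)[of 0] by linarith
  show "0 \<le> L * (\<bar>\<alpha>\<bar> + \<bar>\<beta>\<bar>)" using L by simp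
  fix r x r' x'
  let ?u = "\<alpha> * r + \<beta> * x + \<gamma>" and ?v = "\<alpha> * r' + \<beta> * x' + \<gamma>"
  have "\<bar>f ?u - f ?v\<bar> \<le> L * \<bar>?u - ?v\<bar>"
    using field_differentiable_bound[of UNIV f f' L ?u ?v] f by (auto simp: has_field_derivative_at_within)
  also have "\<bar>?u - ?v\<bar> = \<bar>\<alpha> * (r - r') + \<beta> * (x - x')\<bar>" by (simp add: algebra_simps)
  also have "\<bar>\<alpha> * (r - r') + \<beta> * (x - x')\<bar> \<le> \<bar>\<alpha>\<bar> * \<bar>r - r'\<bar> + \<bar>\<beta>\<bar> * \<bar>x - x'\<bar>"
    by (metis abs_mult abs_triangle_ineq)
  also have "\<dots> \<le> (\<bar>\<alpha>\<bar> + \<bar>\<beta>\<bar>) * (\<bar>r - r'\<bar> + \<bar>x - x'\<bar>)"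
    by (simp add: algebra_simps)
  finally show "\<bar>f ?u - f ?v\<bar> \<le> L * (\<bar>\<alpha>\<bar> + \<bar>\<beta>\<bar>) * (\<bar>r - r'\<bar> + \<bar>x - x'\<bar>)"
    using L by (simp add: mult_left_mono mult.assoc)
qed (use f in auto)

lemma bdd_lipschitz_exp:
  assumes "0 \<le> k"
  shows "bdd_lipschitz T (\<lambda>r x. exp (k * r))"
proof (rule bdd_lipschitzI[of "exp (k * T)" "k * exp (k * T)"])
  fix r r' x x' :: real assume r: "r \<in> {0..T}" "r' \<in> {0..T}"
  have "\<bar>exp (k * r) - exp (k * r')\<bar> \<le> k * exp (k * T) * \<bar>r - r'\<bar>"
  proof -
    have "norm (exp (k * r) - exp (k * r')) \<le> k * exp (k * T) * norm (r - r')"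
    proof (rule field_differentiable_bound[of "{0..T}" _ "\<lambda>r. k * exp (k * r)"])
      show "((\<lambda>r. exp (k * r)) has_field_derivative k * exp (k * z)) (at z within {0..T})" for z
        by (auto intro!: derivative_eq_intros)
      show "norm (k * exp (k * z)) \<le> k * exp (k * T)" if "z \<in> {0..T}" for z
        using that assms by (auto simp: abs_mult intro!: mult_left_mono)
    qed (use r in auto)
    then show ?thesis by simp
  qed
  also have "\<dots> \<le> k * exp (k * T) * (\<bar>r - r'\<bar> + \<bar>x - x'\<bar>)"
    using assms by (intro mult_left_mono) auto
  finally show "\<bar>exp (k * r) - exp (k * r')\<bar> \<le> k * exp (k * T) * (\<bar>r - r'\<bar> + \<bar>x - x'\<bar>)" .
qed (use assms in \<open>auto intro: mult_left_mono\<close>)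

lemma abs_tanh_le_1: "\<bar>tanh (u::real)\<bar> \<le> 1"
  using tanh_real_bounds[of u] by auto

lemma bdd_lipschitz_cos: "bdd_lipschitz T (\<lambda>r x. cos (\<alpha> * r + \<beta> * x + \<gamma>))"
  by (rule bdd_lipschitz_affine[where f' = "\<lambda>u. - sin u" and L = 1 and B = 1])
    (auto intro!: derivative_eq_intros)

lemma bdd_lipschitz_sin: "bdd_lipschitz T (\<lambda>r x. sin (\<alpha> * r + \<beta> * x + \<gamma>))"
  by (rule bdd_lipschitz_affine[where f' = "\<lambda>u. cos u" and L = 1 and B = 1])
    (auto intro!: derivative_eq_intros)

lemma bdd_lipschitz_tanh: "bdd_lipschitz T (\<lambda>r x. tanh (\<beta> * x))"
proof -
  have "\<bar>1 - (tanh u)\<^sup>2\<bar> \<le> 1" for u :: real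
    using abs_tanh_le_1[of u] by (simp add: abs_square_le_1)
  then have "bdd_lipschitz T (\<lambda>r x. tanh (0 * r + \<beta> * x + 0))"
    by (intro bdd_lipschitz_affine[where f' = "\<lambda>u. 1 - (tanh u)\<^sup>2" and L = 1 and B = 1])
      (auto intro!: derivative_eq_intros abs_tanh_le_1)
  then show ?thesis by simp
qed

lemma bdd_lipschitz_measurable:
  assumes "bdd_lipschitz T f" "r \<in> {0..T}"
  shows "f r \<in> borel_measurable borel"
proof -
  obtain K where K: "0 \<le> K" "\<And>r x r' x'. r \<in> {0..T} \<Longrightarrow> r' \<in> {0..T} \<Longrightarrow>
      \<bar>f r x - f r' x'\<bar> \<le> K * (\<bar>r - r'\<bar> + \<bar>x - x'\<bar>)"
    using assms(1) unfolding bdd_lipschitz_def by blast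
  have "K-lipschitz_on UNIV (f r)"
    using K(1) K(2)[OF assms(2) assms(2)] by (intro lipschitz_onI) (auto simp: dist_real_def)
  then show ?thesis
    by (intro borel_measurable_continuous_onI lipschitz_on_continuous_on)
qed

lemmas bdd_lipschitz_intros = bdd_lipschitz_const bdd_lipschitz_add bdd_lipschitz_mult
  bdd_lipschitz_exp bdd_lipschitz_cos bdd_lipschitz_sin bdd_lipschitz_tanh

lemma taylor_order2_lipschitz:
  fixes f f' f'' :: "real \<Rightarrow> real"
  assumes f: "\<And>u. (f has_real_derivative f' u) (at u)" "\<And>u. (f' has_real_derivative f'' u) (at u)"
    and L: "\<And>u v. \<bar>f'' u - f'' v\<bar> \<le> K * \<bar>u - v\<bar>" "0 \<le> K"
  shows "\<bar>f (x + d) - f x - d * f' x - d\<^sup>2 / 2 * f'' x\<bar> \<le> K * \<bar>d\<bar> ^ 3"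
proof (cases "d = 0")
  case False
  let ?diff = "\<lambda>m::nat. if m = 0 then f else if m = 1 then f' else f''"
  have "\<exists>t. (if x + d < x then x + d < t \<and> t < x else x < t \<and> t < x + d) \<and>
     f (x + d) = (\<Sum>m<2. ?diff m x / fact m * (x + d - x) ^ m) + ?diff 2 t / fact 2 * (x + d - x)\<^sup>2"
    by (rule Taylor[where a = "x - \<bar>d\<bar>" and b = "x + \<bar>d\<bar>"])
      (use f False in \<open>auto simp: less_2_cases_iff\<close>)
  then obtain t where t0: "if x + d < x then x + d < t \<and> t < x else x < t \<and> t < x + d"
     "f (x + d) = (\<Sum>m<2. ?diff m x / fact m * (x + d - x) ^ m) + ?diff 2 t / fact 2 * (x + d - x)\<^sup>2"
    by blast
  have t: "\<bar>t - x\<bar> \<le> \<bar>d\<bar>" "f (x + d) = f x + d * f' x + d\<^sup>2 / 2 * f'' t"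
    using t0 by (auto simp: numeral_2_eq_2 split: if_splits)
  have "\<bar>f (x + d) - f x - d * f' x - d\<^sup>2 / 2 * f'' x\<bar> = d\<^sup>2 / 2 * \<bar>f'' t - f'' x\<bar>"
  proof -
    have "f (x + d) - f x - d * f' x - d\<^sup>2 / 2 * f'' x = d\<^sup>2 / 2 * (f'' t - f'' x)"
      unfolding t(2) by (simp add: algebra_simps)
    then show ?thesis by (simp only: abs_mult) simp
  qed
  also have "\<dots> \<le> d\<^sup>2 / 2 * (K * \<bar>d\<bar>)"
    using L(1)[of t x] t(1) L(2) by (intro mult_left_mono order_trans[OF L(1)] mult_left_mono) auto
  also have "\<dots> \<le> K * \<bar>d\<bar> ^ 3"
  proof -
    have "\<bar>d\<bar> ^ 3 = d\<^sup>2 * \<bar>d\<bar>" by (simp add: power2_eq_square power3_eq_cube)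
    moreover have "0 \<le> K * (d\<^sup>2 * \<bar>d\<bar>)" using L(2) by (intro mult_nonneg_nonneg) auto
    ultimately show ?thesis by (simp add: mult_ac)
  qed
  finally show ?thesis .
qed simp

text \<open>On the diffusive scale \<open>z = sqrt h * y\<close> each remainder term of the expansion below is of
  order \<open>h * sqrt h\<close> times a polynomial of degree at most \<open>3\<close> in \<open>\<bar>y\<bar>\<close>. Bounding that polynomial
  by a multiple of \<open>1 + y ^ 4\<close> means that only the fourth moment of the noise will be required.\<close>

lemma diffusion_scaling_bound:
  assumes h: "0 < h" "h \<le> T" and A: "0 \<le> A" and \<eta>: "\<bar>\<eta>\<bar> \<le> A * h"
  defines "C \<equiv> 8 * ((1 + A) * sqrt T + 1 + (A * sqrt T + 1) ^ 3 + A + A\<^sup>2 * sqrt T)"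
  shows "h * (h + \<bar>\<eta>\<bar> + \<bar>z\<bar>) + (\<bar>\<eta>\<bar> + \<bar>z\<bar>) ^ 3 + (\<bar>z * \<eta>\<bar> + \<eta>\<^sup>2 / 2)
    \<le> C * (h * sqrt h * (1 + z ^ 4 / h\<^sup>2))"
proof -
  define k where "k = sqrt h"
  define y where "y = \<bar>z\<bar> / k"
  define \<kappa> where "\<kappa> = sqrt T"
  have k: "0 < k" "k \<le> \<kappa>" "h = k * k" using h by (auto simp: k_def \<kappa>_def)
  have y: "0 \<le> y" "\<bar>z\<bar> = k * y" using k by (auto simp: y_def)
  have z4: "z ^ 4 / h\<^sup>2 = y ^ 4"
  proof -
    have "z ^ 4 = \<bar>z\<bar> ^ 4" by simp
    also have "\<dots> = k ^ 4 * y ^ 4" by (simp add: y power_mult_distrib)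
    finally show ?thesis using k by (simp add: k(3) power2_eq_square eval_nat_numeral)
  qed
  have \<eta>k: "\<bar>\<eta>\<bar> \<le> k * (A * \<kappa>)" 
  proof -
    have "A * (k * k) \<le> A * (k * \<kappa>)" using k A by (intro mult_left_mono) auto
    then show ?thesis using \<eta> unfolding k(3) by (simp only: mult_ac)
  qed
  have \<eta>2: "\<bar>\<eta>\<bar> \<le> A * (k * k)" using \<eta> k by simp
  have t1: "h * (h + \<bar>\<eta>\<bar> + \<bar>z\<bar>) \<le> (k * k * k) * ((1 + A) * \<kappa> + y)"
  proof -
    have "h + \<bar>\<eta>\<bar> + \<bar>z\<bar> \<le> k * ((1 + A) * \<kappa> + y)"
    proof -
      have "k * k \<le> k * \<kappa>" using k by (intro mult_left_mono) auto
      then show ?thesis using \<eta>k y(2) unfolding k(3) by (simp add: algebra_simps)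
    qed
    moreover have "0 \<le> k * k" by simp
    ultimately have "(k * k) * (h + \<bar>\<eta>\<bar> + \<bar>z\<bar>) \<le> (k * k) * (k * ((1 + A) * \<kappa> + y))"
      by (rule mult_left_mono)
    then show ?thesis unfolding k(3) by (simp only: mult_ac)
  qed
  have t2: "(\<bar>\<eta>\<bar> + \<bar>z\<bar>) ^ 3 \<le> (k * k * k) * (A * \<kappa> + y) ^ 3"
  proof -
    have "\<bar>\<eta>\<bar> + \<bar>z\<bar> \<le> k * (A * \<kappa> + y)" using \<eta>k y by (simp add: algebra_simps)
    then have "(\<bar>\<eta>\<bar> + \<bar>z\<bar>) ^ 3 \<le> (k * (A * \<kappa> + y)) ^ 3" by (intro power_mono) auto
    then show ?thesis by (simp only: power_mult_distrib power3_eq_cube mult_ac)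
  qed
  have t3: "\<bar>z * \<eta>\<bar> + \<eta>\<^sup>2 / 2 \<le> (k * k * k) * (A * y + A\<^sup>2 * \<kappa>)"
  proof -
    have "\<bar>z * \<eta>\<bar> \<le> (k * y) * (A * (k * k))"
      unfolding abs_mult y using \<eta>2 y k by (intro mult_left_mono) auto
    moreover have "\<eta>\<^sup>2 / 2 \<le> (k * (A * \<kappa>)) * (A * (k * k))"
    proof -
      have "\<eta>\<^sup>2 \<le> (k * (A * \<kappa>)) * (A * (k * k))"
        using mult_mono[OF \<eta>k \<eta>2] k A by (simp add: power2_eq_square flip: abs_mult)
      then show ?thesis using zero_le_power2[of \<eta>] by linarith
    qed
    ultimately show ?thesis by (simp add: algebra_simps power2_eq_square)
  qed
  have kap: "0 \<le> \<kappa>" using k by linarith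
  define c where "c = (1 + A) * \<kappa> + 1 + (A * \<kappa> + 1) ^ 3 + A + A\<^sup>2 * \<kappa>"
  have c0: "0 \<le> c" unfolding c_def using A kap by auto
  have poly: "((1 + A) * \<kappa> + y) + (A * \<kappa> + y) ^ 3 + (A * y + A\<^sup>2 * \<kappa>) \<le> c * (1 + y) ^ 3"
  proof -
    have y3: "1 + y \<le> (1 + y) ^ 3" "1 \<le> (1 + y) ^ 3"
      using y(1) self_le_power[of "1 + y" 3] by auto
    have "(1 + A) * \<kappa> + y \<le> ((1 + A) * \<kappa> + 1) * (1 + y) ^ 3"
      using y3 A kap mult_left_mono[OF y3(2), of "(1 + A) * \<kappa>"] by (simp add: algebra_simps)
    moreover have "(A * \<kappa> + y) ^ 3 \<le> (A * \<kappa> + 1) ^ 3 * (1 + y) ^ 3"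
      unfolding power_mult_distrib[symmetric] using y A kap by (intro power_mono) (auto simp: algebra_simps)
    moreover have "A * y \<le> A * (1 + y) ^ 3"
      using A y3 by (intro mult_left_mono) auto
    moreover have "A\<^sup>2 * \<kappa> \<le> A\<^sup>2 * \<kappa> * (1 + y) ^ 3"
      using mult_left_mono[OF y3(2), of "A\<^sup>2 * \<kappa>"] kap by simp
    ultimately show ?thesis unfolding c_def by (simp add: ring_distribs)
  qed
  have y4: "(1 + y) ^ 3 \<le> 8 * (1 + y ^ 4)"
  proof (cases "y \<le> 1")
    case True
    then have "(1 + y) ^ 3 \<le> 2 ^ 3" using y by (intro power_mono) auto
    also have "\<dots> \<le> 8 * (1 + y ^ 4)" by simp
    finally show ?thesis .
  next
    case False
    then have "(1 + y) ^ 3 \<le> (2 * y) ^ 3" by (intro power_mono) auto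
    also have "\<dots> = 8 * y ^ 3" by (simp add: power_mult_distrib)
    also have "\<dots> \<le> 8 * y ^ 4" using False power_increasing[of 3 4 y] by simp
    also have "\<dots> \<le> 8 * (1 + y ^ 4)" by simp
    finally show ?thesis .
  qed
  have k3: "0 \<le> k * k * k" using k(1) by simp
  have "h * (h + \<bar>\<eta>\<bar> + \<bar>z\<bar>) + (\<bar>\<eta>\<bar> + \<bar>z\<bar>) ^ 3 + (\<bar>z * \<eta>\<bar> + \<eta>\<^sup>2 / 2)
    \<le> (k * k * k) * (((1 + A) * \<kappa> + y) + (A * \<kappa> + y) ^ 3 + (A * y + A\<^sup>2 * \<kappa>))"
    using t1 t2 t3 unfolding distrib_left[of "k * k * k"] by linarith
  also have "\<dots> \<le> (k * k * k) * (c * (8 * (1 + y ^ 4)))"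
    by (rule mult_left_mono[OF order_trans[OF poly mult_left_mono[OF y4 c0]] k3])
  also have "\<dots> = C * (h * sqrt h * (1 + z ^ 4 / h\<^sup>2))"
    unfolding z4 C_def c_def \<kappa>_def[symmetric] k_def[symmetric] k(3)[symmetric]
    by (simp only: mult_ac)
  finally show ?thesis .
qed

text \<open>One step of Ito's formula as a pathwise inequality. The displacement is split into a drift
  part \<open>\<eta>\<close> and a noise part \<open>z\<close>; the terms of order \<open>h\<close> cancel by the backward equation once
  \<open>z\<^sup>2\<close> has been compensated by \<open>h\<close>. What remains is the error of replacing the drift by its
  value at the left end point, and a term of order \<open>h * sqrt h\<close> that is summable over a grid.\<close>

lemma ito_step:
  fixes g gr gx gxx :: "real \<Rightarrow> real \<Rightarrow> real"
  assumes dr: "\<And>r x. ((\<lambda>r. g r x) has_real_derivative gr r x) (at r)"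
    and dx: "\<And>r x. (g r has_real_derivative gx r x) (at x)"
    and dxx: "\<And>r x. (gx r has_real_derivative gxx r x) (at x)"
    and lip: "bdd_lipschitz T gr" "bdd_lipschitz T gx" "bdd_lipschitz T gxx"
    and pde: "\<And>r x. gr r x + b x * gx r x + gxx r x / 2 = 0"
    and A: "0 \<le> A" and T: "0 \<le> T"
  obtains D where "0 \<le> D"
    "\<And>r h x \<eta> z. 0 \<le> r \<Longrightarrow> 0 < h \<Longrightarrow> r + h \<le> T \<Longrightarrow> \<bar>\<eta>\<bar> \<le> A * h \<Longrightarrow>
      \<bar>g (r + h) (x + \<eta> + z) - g r x - z * gx r x - (z\<^sup>2 - h) * (gxx r x / 2)\<bar>
      \<le> D * \<bar>\<eta> - b x * h\<bar> + D * (h * sqrt h * (1 + z ^ 4 / h\<^sup>2))"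
proof -
  obtain K1 where K1: "0 \<le> K1" "\<And>r x. r \<in> {0..T} \<Longrightarrow> \<bar>gr r x\<bar> \<le> K1"
    "\<And>r x r' x'. r \<in> {0..T} \<Longrightarrow> r' \<in> {0..T} \<Longrightarrow>
      \<bar>gr r x - gr r' x'\<bar> \<le> K1 * (\<bar>r - r'\<bar> + \<bar>x - x'\<bar>)"
    by (rule bdd_lipschitzE[OF lip(1)]) blast
  obtain K2 where K2: "0 \<le> K2" "\<And>r x. r \<in> {0..T} \<Longrightarrow> \<bar>gx r x\<bar> \<le> K2"
    by (rule bdd_lipschitzE[OF lip(2)]) blast
  obtain K3 where K3: "0 \<le> K3" "\<And>r x. r \<in> {0..T} \<Longrightarrow> \<bar>gxx r x\<bar> \<le> K3"
    "\<And>r x r' x'. r \<in> {0..T} \<Longrightarrow> r' \<in> {0..T} \<Longrightarrow>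
      \<bar>gxx r x - gxx r' x'\<bar> \<le> K3 * (\<bar>r - r'\<bar> + \<bar>x - x'\<bar>)"
    by (rule bdd_lipschitzE[OF lip(3)]) blast
  define K where "K = K1 + K2 + K3"
  have K: "0 \<le> K" "K1 \<le> K" "K2 \<le> K" "K3 \<le> K" using K1 K2 K3 by (auto simp: K_def)
  define C where "C = 8 * ((1 + A) * sqrt T + 1 + (A * sqrt T + 1) ^ 3 + A + A\<^sup>2 * sqrt T)"
  have C: "0 \<le> C" unfolding C_def
    using A T by (intro mult_nonneg_nonneg add_nonneg_nonneg zero_le_power) auto
  show ?thesis
  proof (rule that[of "K + K * C"])
    show "0 \<le> K + K * C" using K C by auto
    fix r h x \<eta> z :: real
    assume rh: "0 \<le> r" "0 < h" "r + h \<le> T" and \<eta>: "\<bar>\<eta>\<bar> \<le> A * h"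
    have r: "r \<in> {0..T}" using rh by auto
    define d where "d = \<eta> + z"
    \<comment> \<open>\<open>e1\<close>: the time derivative is taken at the starting point; \<open>e2\<close>: the cubic Taylor remainder in space; \<open>e3\<close>: the part of \<open>(\<eta> + z)\<^sup>2\<close> other than \<open>z\<^sup>2\<close>.\<close>
    define e1 where "e1 = g (r + h) (x + d) - g r (x + d) - h * gr r x"
    define e2 where "e2 = g r (x + d) - g r x - d * gx r x - d\<^sup>2 / 2 * gxx r x"
    define e3 where "e3 = (z * \<eta> + \<eta>\<^sup>2 / 2) * gxx r x"
    have d: "\<bar>d\<bar> \<le> \<bar>\<eta>\<bar> + \<bar>z\<bar>" by (simp add: d_def)
    have E1: "\<bar>e1\<bar> \<le> K * (h * (h + \<bar>\<eta>\<bar> + \<bar>z\<bar>))"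
    proof -
      obtain \<xi> where \<xi>: "r < \<xi>" "\<xi> < r + h"
        "g (r + h) (x + d) - g r (x + d) = (r + h - r) * gr \<xi> (x + d)"
        using MVT2[of r "r + h" "\<lambda>r. g r (x + d)" "\<lambda>r. gr r (x + d)", OF _ dr] rh(2) by auto
      have "e1 = h * (gr \<xi> (x + d) - gr r x)"
        unfolding e1_def \<xi>(3) by (simp add: algebra_simps)
      then have "\<bar>e1\<bar> = h * \<bar>gr \<xi> (x + d) - gr r x\<bar>" using rh by (simp add: abs_mult)
      also have "\<dots> \<le> h * (K1 * (\<bar>\<xi> - r\<bar> + \<bar>x + d - x\<bar>))"
        using \<xi> rh by (intro mult_left_mono K1(3)) auto
      also have "\<dots> \<le> h * (K * (h + \<bar>\<eta>\<bar> + \<bar>z\<bar>))"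
        using \<xi> rh K K1(1) d by (intro mult_left_mono mult_mono) auto
      finally show ?thesis by (simp add: mult_ac)
    qed
    have E2: "\<bar>e2\<bar> \<le> K * (\<bar>\<eta>\<bar> + \<bar>z\<bar>) ^ 3"
    proof -
      have "\<bar>e2\<bar> \<le> K3 * \<bar>d\<bar> ^ 3"
        unfolding e2_def
        by (rule taylor_order2_lipschitz[OF dx dxx _ K3(1)]) (use K3(3)[OF r r] in auto)
      also have "\<dots> \<le> K * (\<bar>\<eta>\<bar> + \<bar>z\<bar>) ^ 3"
        using K d by (intro mult_mono power_mono) auto
      finally show ?thesis .
    qed
    have E3: "\<bar>e3\<bar> \<le> K * (\<bar>z * \<eta>\<bar> + \<eta>\<^sup>2 / 2)"
    proof -
      have "\<bar>e3\<bar> = \<bar>gxx r x\<bar> * \<bar>z * \<eta> + \<eta>\<^sup>2 / 2\<bar>" by (simp add: e3_def abs_mult)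
      also have "\<dots> \<le> K * (\<bar>z * \<eta>\<bar> + \<eta>\<^sup>2 / 2)"
        using K3(2)[OF r, of x] K abs_triangle_ineq[of "z * \<eta>" "\<eta>\<^sup>2 / 2"]
        by (intro mult_mono) auto
      finally show ?thesis .
    qed
    have E4: "\<bar>(\<eta> - b x * h) * gx r x\<bar> \<le> K * \<bar>\<eta> - b x * h\<bar>"
      unfolding abs_mult using K2(2)[OF r, of x] K by (subst mult.commute, intro mult_right_mono) auto
    have "g (r + h) (x + \<eta> + z) - g r x - z * gx r x - (z\<^sup>2 - h) * (gxx r x / 2)
       = e1 + e2 + e3 + (\<eta> - b x * h) * gx r x + h * (gr r x + b x * gx r x + gxx r x / 2)"
      unfolding e1_def e2_def e3_def d_def
      by (simp add: algebra_simps power2_eq_square add_divide_distrib diff_divide_distrib)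
    then have "\<bar>g (r + h) (x + \<eta> + z) - g r x - z * gx r x - (z\<^sup>2 - h) * (gxx r x / 2)\<bar>
       \<le> \<bar>e1\<bar> + \<bar>e2\<bar> + \<bar>e3\<bar> + \<bar>(\<eta> - b x * h) * gx r x\<bar>"
      unfolding pde by linarith
    also have "\<dots> \<le> K * (h * (h + \<bar>\<eta>\<bar> + \<bar>z\<bar>) + (\<bar>\<eta>\<bar> + \<bar>z\<bar>) ^ 3 + (\<bar>z * \<eta>\<bar> + \<eta>\<^sup>2 / 2))
        + K * \<bar>\<eta> - b x * h\<bar>"
      using E1 E2 E3 E4 by (simp add: distrib_left)
    also have "\<dots> \<le> K * (C * (h * sqrt h * (1 + z ^ 4 / h\<^sup>2))) + K * \<bar>\<eta> - b x * h\<bar>"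
      using diffusion_scaling_bound[OF rh(2) _ A \<eta>, of T z] rh K(1)
      unfolding C_def[symmetric] by (intro add_right_mono mult_left_mono) auto
    also have "\<dots> \<le> (K + K * C) * \<bar>\<eta> - b x * h\<bar> + (K + K * C) * (h * sqrt h * (1 + z ^ 4 / h\<^sup>2))"
    proof -
      have "0 \<le> h * sqrt h * (1 + z ^ 4 / h\<^sup>2)" using rh by auto
      then have "0 \<le> K * (h * sqrt h * (1 + z ^ 4 / h\<^sup>2))" using K by auto
      moreover have "0 \<le> K * C * \<bar>\<eta> - b x * h\<bar>" using K C by auto
      ultimately show ?thesis by (simp add: distrib_right mult.assoc)
    qed
    finally show "\<bar>g (r + h) (x + \<eta> + z) - g r x - z * gx r x - (z\<^sup>2 - h) * (gxx r x / 2)\<bar>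
      \<le> (K + K * C) * \<bar>\<eta> - b x * h\<bar> + (K + K * C) * (h * sqrt h * (1 + z ^ 4 / h\<^sup>2))" .
  qed
qed

section \<open>Diffusions with additive noise and bounded drift\<close>

context brownian
begin

lemma increment_indep_var:
  fixes U :: "'a \<Rightarrow> real"
  assumes s: "s \<in> {0..T}" and t: "t \<in> {s<..T}" and U: "U \<in> borel_measurable (F s)"
  shows "indep_var borel U borel (\<lambda>\<omega>. W t \<omega> - W s \<omega>)"
proof -
  let ?z = "\<lambda>\<omega>. W t \<omega> - W s \<omega>"
  have [measurable]: "W t \<in> borel_measurable M" "W s \<in> borel_measurable M"
    using W_measurable s t by auto
  have UM: "U \<in> borel_measurable M" using measurable_F_M[OF U s] .
  have sU: "sigma_sets (space M) {U -` A \<inter> space M | A. A \<in> sets borel} \<subseteq> sets (F s)"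
  proof -
    have "{U -` A \<inter> space M | A. A \<in> sets borel} \<subseteq> sets (F s)"
      using measurable_sets[OF U] space_F by auto
    from sets.sigma_sets_subset[OF this] show ?thesis by (simp add: space_F)
  qed
  have sz: "sigma_sets (space M) {?z -` A \<inter> space M | A. A \<in> sets borel}
     = {?z -` A \<inter> space M | A. A \<in> sets borel}"
    using sigma_sets_vimage_commute[of ?z "space M" "space borel" "sets borel"]
      sets.sigma_sets_eq[of "borel :: real measure"] by simp
  note ind = increment_indep_set[OF s t]
  show ?thesis
    unfolding indep_var_eq sz
  proof (intro conjI indep_setI)
    show "sigma_sets (space M) {U -` A \<inter> space M | A. A \<in> sets borel} \<subseteq> events"
      using sU sets_F_le[OF s] by blast
    show "{?z -` A \<inter> space M | A. A \<in> sets borel} \<subseteq> events"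
      by auto
    fix a b assume "a \<in> sigma_sets (space M) {U -` A \<inter> space M | A. A \<in> sets borel}"
      "b \<in> {?z -` A \<inter> space M | A. A \<in> sets borel}"
    then show "prob (a \<inter> b) = prob a * prob b"
      using sU by (intro indep_setD[OF ind]) auto
  qed (use UM in auto)
qed

lemma increment_moments:
  assumes s: "s \<in> {0..T}" and t: "t \<in> {s<..T}"
  shows "integrable M (\<lambda>\<omega>. (W t \<omega> - W s \<omega>) ^ k)"
    and "expectation (\<lambda>\<omega>. W t \<omega> - W s \<omega>) = 0"
    and "expectation (\<lambda>\<omega>. (W t \<omega> - W s \<omega>)\<^sup>2) = t - s"
    and "expectation (\<lambda>\<omega>. (W t \<omega> - W s \<omega>) ^ 4) = 3 * (t - s)\<^sup>2"
proof -
  let ?\<sigma> = "sqrt (t - s)"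
  have \<sigma>: "0 < ?\<sigma>" using t by simp
  note d = increment_distributed[OF s t]
  have int: "expectation (\<lambda>\<omega>. (W t \<omega> - W s \<omega>) ^ k) = (\<integral>x. normal_density 0 ?\<sigma> x * x ^ k \<partial>lborel)" for k
    by (rule distributed_integral[OF d, symmetric]) auto
  show "integrable M (\<lambda>\<omega>. (W t \<omega> - W s \<omega>) ^ k)"
    using distributed_integrable[OF d, of "\<lambda>x. x ^ k"] integrable_normal_moment[OF \<sigma>, of 0 k] by simp
  show "expectation (\<lambda>\<omega>. W t \<omega> - W s \<omega>) = 0"
    using int[of 1] integral_normal_moment_odd[OF \<sigma>, of 0 0] by simp
  show "expectation (\<lambda>\<omega>. (W t \<omega> - W s \<omega>)\<^sup>2) = t - s"
    using int[of 2] integral_normal_moment_even[OF \<sigma>, of 0 1] t by (simp add: fact_numeral)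
  show "expectation (\<lambda>\<omega>. (W t \<omega> - W s \<omega>) ^ 4) = 3 * (t - s)\<^sup>2"
  proof -
    have "sqrt (t - s) ^ 4 = ((sqrt (t - s))\<^sup>2)\<^sup>2" by (simp only: power_mult[symmetric]) simp
    also have "(sqrt (t - s))\<^sup>2 = t - s" using t by simp
    finally show ?thesis
      using int[of 4] integral_normal_moment_even[OF \<sigma>, of 0 2]
      by (simp add: fact_numeral power_divide)
  qed
qed

text \<open>The two first-order terms of \<open>ito_step\<close> vanish in expectation, also after multiplication by
  any bounded quantity known at time \<open>s\<close>.\<close>

lemma increment_centered:
  fixes U :: "'a \<Rightarrow> real"
  assumes s: "s \<in> {0..T}" and t: "t \<in> {s<..T}" and U: "U \<in> borel_measurable (F s)"
    and bound: "\<And>\<omega>. \<bar>U \<omega>\<bar> \<le> B"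
  shows "integrable M (\<lambda>\<omega>. U \<omega> * (W t \<omega> - W s \<omega>))"
    and "expectation (\<lambda>\<omega>. U \<omega> * (W t \<omega> - W s \<omega>)) = 0"
    and "integrable M (\<lambda>\<omega>. U \<omega> * ((W t \<omega> - W s \<omega>)\<^sup>2 - (t - s)))"
    and "expectation (\<lambda>\<omega>. U \<omega> * ((W t \<omega> - W s \<omega>)\<^sup>2 - (t - s))) = 0"
proof -
  let ?z = "\<lambda>\<omega>. W t \<omega> - W s \<omega>"
  note ind = increment_indep_var[OF s t U]
  note mom = increment_moments[OF s t]
  have ind2: "indep_var borel U borel (\<lambda>\<omega>. (?z \<omega>)\<^sup>2 - (t - s))"
    using indep_var_compose[OF ind, of "\<lambda>x. x" borel "\<lambda>z. z\<^sup>2 - (t - s)" borel] by (simp add: comp_def)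
  have iU: "integrable M U"
    using measurable_F_M[OF U s] bound by (intro integrable_const_bound[of _ B]) auto
  have i1: "integrable M ?z" using mom(1)[of 1] by simp
  have i2: "integrable M (\<lambda>\<omega>. (?z \<omega>)\<^sup>2 - (t - s))" using mom(1)[of 2] by simp
  show "integrable M (\<lambda>\<omega>. U \<omega> * ?z \<omega>)"
    by (rule indep_var_integrable[OF ind iU i1])
  show "expectation (\<lambda>\<omega>. U \<omega> * ?z \<omega>) = 0"
    by (subst indep_var_lebesgue_integral[OF ind iU i1]) (simp add: mom)
  show "integrable M (\<lambda>\<omega>. U \<omega> * ((?z \<omega>)\<^sup>2 - (t - s)))"
    by (rule indep_var_integrable[OF ind2 iU i2])
  have "expectation (\<lambda>\<omega>. (?z \<omega>)\<^sup>2 - (t - s)) = 0"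
    using mom(1)[of 2] mom(3) by (simp add: prob_space)
  then show "expectation (\<lambda>\<omega>. U \<omega> * ((?z \<omega>)\<^sup>2 - (t - s))) = 0"
    by (subst indep_var_lebesgue_integral[OF ind2 iU i2]) simp
qed

end

lemma uniform_grid_within:
  fixes s t T h :: real
  assumes "k < Suc n" "0 < h" "real (Suc n) * h = t - s" "0 \<le> s" "t \<le> T"
  shows "0 \<le> s + real k * h" "s + real k * h + h \<le> T"
proof -
  have "(real k + 1) * h \<le> real (Suc n) * h"
    using assms(1,2) by (intro mult_right_mono) auto
  then show "s + real k * h + h \<le> T" unfolding assms(3) using assms(5) by (simp add: algebra_simps)
  show "0 \<le> s + real k * h" using assms(2,4) by simp
qed

text \<open>The noise is additive, so \<open>X - W\<close> is an ordinary integral of a continuous bounded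
  function along each path, and its increments can be estimated path by path.\<close>

locale bounded_drift_diffusion = brownian M F T W
  for M :: "'a measure" and F T W +
  fixes x0 :: real and b :: "real \<Rightarrow> real" and X :: "real \<Rightarrow> 'a \<Rightarrow> real" and A :: real
  assumes solution: "sde_solution M F T x0 (\<lambda>x _. b x) W X"
    and drift_continuous: "continuous_on UNIV b"
    and drift_bounded: "\<And>x. \<bar>b x\<bar> \<le> A"
begin

lemma A_nonneg: "0 \<le> A"
  using drift_bounded[of 0] by linarith

lemma X_adapted: "t \<in> {0..T} \<Longrightarrow> X t \<in> borel_measurable (F t)"
  using solution by (simp add: sde_solution_def)

lemma X_measurable: "t \<in> {0..T} \<Longrightarrow> X t \<in> borel_measurable M"
  using X_adapted measurable_F_M by blast

lemma X_continuous: "AE \<omega> in M. continuous_on {0..T} (\<lambda>t. X t \<omega>)"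
  using solution by (simp add: sde_solution_def)

lemma drift_measurable [measurable]: "b \<in> borel_measurable borel"
  using drift_continuous by (rule borel_measurable_continuous_onI)

lemma X_start: "AE \<omega> in M. X 0 \<omega> = x0"
proof -
  have "AE \<omega> in M. \<forall>t\<in>{0..T}. ((\<lambda>s. b (X s \<omega>)) has_integral (X t \<omega> - x0 - W t \<omega>)) {0..t}"
    using solution by (simp add: sde_solution_def)
  then show ?thesis using W_start
  proof eventually_elim
    case (elim \<omega>)
    have "0 \<in> {0..T}" using horizon_nonneg by simp
    with elim(1) have "((\<lambda>s. b (X s \<omega>)) has_integral (X 0 \<omega> - x0 - W 0 \<omega>)) {0..0}"
      by blast
    then have "X 0 \<omega> - x0 - W 0 \<omega> = 0" by (simp add: has_integral_iff)
    then show ?case using elim by simp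
  qed
qed

definition drift_increment :: "real \<Rightarrow> real \<Rightarrow> 'a \<Rightarrow> real" where
  "drift_increment r h \<omega> = X (r + h) \<omega> - X r \<omega> - (W (r + h) \<omega> - W r \<omega>)"

lemma drift_increment_has_integral:
  "AE \<omega> in M. \<forall>r h. 0 \<le> r \<longrightarrow> 0 \<le> h \<longrightarrow> r + h \<le> T \<longrightarrow>
     ((\<lambda>u. b (X u \<omega>)) has_integral drift_increment r h \<omega>) {r..r + h}"
proof -
  have "AE \<omega> in M. \<forall>t\<in>{0..T}. ((\<lambda>s. b (X s \<omega>)) has_integral (X t \<omega> - x0 - W t \<omega>)) {0..t}"
    using solution by (simp add: sde_solution_def)
  then show ?thesis
  proof (eventually_elim, intro allI impI)
    fix \<omega> and r h :: real
    assume all: "\<forall>t\<in>{0..T}. ((\<lambda>s. b (X s \<omega>)) has_integral (X t \<omega> - x0 - W t \<omega>)) {0..t}"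
    assume rh: "0 \<le> r" "0 \<le> h" "r + h \<le> T"
    let ?f = "\<lambda>s. b (X s \<omega>)"
    have 1: "(?f has_integral (X r \<omega> - x0 - W r \<omega>)) {0..r}"
      and 2: "(?f has_integral (X (r + h) \<omega> - x0 - W (r + h) \<omega>)) {0..r + h}"
      using all rh by auto
    have "?f integrable_on {r..r + h}"
      using 2 rh by (intro integrable_on_subinterval[of ?f "{0..r + h}" r "r + h"]) auto
    then obtain I where I: "(?f has_integral I) {r..r + h}" by auto
    have "(?f has_integral (X r \<omega> - x0 - W r \<omega> + I)) {0..r + h}"
      using has_integral_combine[OF _ _ 1 I] rh by auto
    then have "I = drift_increment r h \<omega>"
      using has_integral_unique[OF _ 2] unfolding drift_increment_def by fastforce
    then show "(?f has_integral drift_increment r h \<omega>) {r..r + h}" using I by simp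
  qed
qed

lemma drift_increment_bound:
  "AE \<omega> in M. \<forall>r h. 0 \<le> r \<longrightarrow> 0 \<le> h \<longrightarrow> r + h \<le> T \<longrightarrow> \<bar>drift_increment r h \<omega>\<bar> \<le> A * h"
  using drift_increment_has_integral
proof (eventually_elim, intro allI impI)
  fix \<omega> r h
  assume "\<forall>r h. 0 \<le> r \<longrightarrow> 0 \<le> h \<longrightarrow> r + h \<le> T \<longrightarrow>
     ((\<lambda>u. b (X u \<omega>)) has_integral drift_increment r h \<omega>) {r..r + h}"
    and rh: "0 \<le> r" "0 \<le> h" "r + h \<le> T"
  then have "((\<lambda>u. b (X u \<omega>)) has_integral drift_increment r h \<omega>) {r..r + h}" by blast
  from has_integral_bound_real[OF A_nonneg finite.emptyI this]
  show "\<bar>drift_increment r h \<omega>\<bar> \<le> A * h" using drift_bounded rh by auto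
qed

text \<open>The error made by one explicit Euler step of length \<open>h\<close> starting at the true position.\<close>

definition euler_residual :: "real \<Rightarrow> real \<Rightarrow> 'a \<Rightarrow> real" where
  "euler_residual r h \<omega> = \<bar>drift_increment r h \<omega> - b (X r \<omega>) * h\<bar>"

lemma drift_increment_measurable:
  assumes "0 \<le> r" "0 \<le> h" "r + h \<le> T"
  shows "drift_increment r h \<in> borel_measurable M"
proof -
  have [measurable]: "X r \<in> borel_measurable M" "X (r + h) \<in> borel_measurable M"
    "W r \<in> borel_measurable M" "W (r + h) \<in> borel_measurable M"
    using X_measurable W_measurable assms by auto
  show ?thesis unfolding drift_increment_def[abs_def] by measurable
qed

lemma euler_residual_measurable:
  assumes "0 \<le> r" "0 \<le> h" "r + h \<le> T"
  shows "euler_residual r h \<in> borel_measurable M"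
proof -
  have [measurable]: "X r \<in> borel_measurable M" "drift_increment r h \<in> borel_measurable M"
    using X_measurable drift_increment_measurable assms by auto
  show ?thesis unfolding euler_residual_def[abs_def] by measurable
qed

lemma euler_residual_bound:
  "AE \<omega> in M. \<forall>r h. 0 \<le> r \<longrightarrow> 0 \<le> h \<longrightarrow> r + h \<le> T \<longrightarrow> euler_residual r h \<omega> \<le> 2 * A * h"
  using drift_increment_bound
proof (eventually_elim, intro allI impI)
  fix \<omega> r h
  assume "\<forall>r h. 0 \<le> r \<longrightarrow> 0 \<le> h \<longrightarrow> r + h \<le> T \<longrightarrow> \<bar>drift_increment r h \<omega>\<bar> \<le> A * h"
    and rh: "0 \<le> r" "0 \<le> h" "r + h \<le> T"
  then have "\<bar>drift_increment r h \<omega>\<bar> \<le> A * h" by blast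
  moreover have "\<bar>b (X r \<omega>) * h\<bar> \<le> A * h"
    unfolding abs_mult using drift_bounded[of "X r \<omega>"] rh by (intro mult_mono) auto
  ultimately show "euler_residual r h \<omega> \<le> 2 * A * h" unfolding euler_residual_def by linarith
qed

lemma euler_residual_integrable:
  assumes r: "0 \<le> r" "0 \<le> h" "r + h \<le> T"
  shows "integrable M (euler_residual r h)"
proof (rule integrable_const_bound[of _ "2 * A * h"])
  show "AE \<omega> in M. norm (euler_residual r h \<omega>) \<le> 2 * A * h"
    using euler_residual_bound
  proof eventually_elim
    case (elim \<omega>)
    then have "euler_residual r h \<omega> \<le> 2 * A * h" using r by blast
    then show ?case by (simp add: euler_residual_def)
  qed
qed (rule euler_residual_measurable[OF r])

text \<open>The drift along a continuous path is uniformly continuous on the compact interval \<open>[0,T]\<close>,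
  so the residual is \<open>o(h)\<close> uniformly in the starting time.\<close>

lemma euler_residual_uniform:
  "AE \<omega> in M. \<forall>\<epsilon>>0. \<exists>\<delta>>0. \<forall>r h. 0 \<le> r \<longrightarrow> 0 \<le> h \<longrightarrow> r + h \<le> T \<longrightarrow> h < \<delta> \<longrightarrow>
     euler_residual r h \<omega> \<le> \<epsilon> * h"
  using drift_increment_has_integral X_continuous
proof eventually_elim
  case (elim \<omega>)
  have "continuous_on {0..T} (\<lambda>u. b (X u \<omega>))"
    using continuous_on_compose2[OF drift_continuous elim(2)] by auto
  then have uc: "uniformly_continuous_on {0..T} (\<lambda>u. b (X u \<omega>))"
    by (rule compact_uniformly_continuous) auto
  show ?case
  proof (intro allI impI)
    fix \<epsilon> :: real assume \<epsilon>: "0 < \<epsilon>"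
    obtain \<delta> where \<delta>: "0 < \<delta>" "\<And>u v. u \<in> {0..T} \<Longrightarrow> v \<in> {0..T} \<Longrightarrow> dist v u < \<delta> \<Longrightarrow>
        dist (b (X v \<omega>)) (b (X u \<omega>)) < \<epsilon>"
      using uc \<epsilon> unfolding uniformly_continuous_on_def by metis
    show "\<exists>\<delta>>0. \<forall>r h. 0 \<le> r \<longrightarrow> 0 \<le> h \<longrightarrow> r + h \<le> T \<longrightarrow> h < \<delta> \<longrightarrow>
        euler_residual r h \<omega> \<le> \<epsilon> * h"
    proof (intro exI[of _ \<delta>] conjI \<delta>(1) allI impI)
      fix r h assume rh: "0 \<le> r" "0 \<le> h" "r + h \<le> T" "h < \<delta>"
      have "((\<lambda>u. b (X u \<omega>)) has_integral drift_increment r h \<omega>) {r..r + h}"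
        using elim(1) rh by blast
      from has_integral_diff[OF this has_integral_const_real[of "b (X r \<omega>)" r "r + h"]]
      have "((\<lambda>u. b (X u \<omega>) - b (X r \<omega>)) has_integral (drift_increment r h \<omega> - b (X r \<omega>) * h)) {r..r + h}"
        using rh by (simp add: mult.commute)
      from has_integral_bound_real[OF _ finite.emptyI this, of \<epsilon>]
      show "euler_residual r h \<omega> \<le> \<epsilon> * h"
        unfolding euler_residual_def using \<epsilon> \<delta>(2)[of r] rh by (auto simp: dist_real_def less_imp_le)
    qed
  qed
qed

text \<open>Path by path the total residual of a grid tends to \<open>0\<close>, and it never exceeds
  \<open>2 * A * (t - s)\<close>; so its expectation tends to \<open>0\<close> by dominated convergence. A rate would require moments of
  the modulus of continuity of \<open>X\<close>.\<close>

lemma euler_residual_sum_tendsto_0: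
  assumes st: "0 \<le> s" "s < t" "t \<le> T"
  defines "h \<equiv> (\<lambda>n. (t - s) / real (Suc n))"
  shows "(\<lambda>n. expectation (\<lambda>\<omega>. \<Sum>k<Suc n. euler_residual (s + real k * h n) (h n) \<omega>)) \<longlonglongrightarrow> 0"
proof -
  have h: "0 < h n" "real (Suc n) * h n = t - s" for n
    using st by (auto simp: h_def simp del: of_nat_Suc)
  have grid: "0 \<le> s + real k * h n" "s + real k * h n + h n \<le> T" if "k < Suc n" for k n
    by (rule uniform_grid_within[OF that h st(1,3)])+
  have hlim: "h \<longlonglongrightarrow> 0"
    unfolding h_def by (rule real_tendsto_divide_at_top[OF tendsto_const])
      (rule filterlim_compose[OF filterlim_real_sequentially filterlim_Suc])
  let ?R = "\<lambda>n \<omega>. \<Sum>k<Suc n. euler_residual (s + real k * h n) (h n) \<omega>"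
  have "(\<lambda>n. expectation (?R n)) \<longlonglongrightarrow> expectation (\<lambda>\<omega>. 0)"
  proof (rule integral_dominated_convergence[where w = "\<lambda>_. 2 * A * (t - s)"])
    show "?R n \<in> borel_measurable M" for n
      using grid h(1)[of n] by (intro borel_measurable_sum euler_residual_measurable) (auto simp: less_imp_le)
    show "AE \<omega> in M. norm (?R n \<omega>) \<le> 2 * A * (t - s)" for n
      using euler_residual_bound
    proof eventually_elim
      case (elim \<omega>)
      have "\<bar>?R n \<omega>\<bar> \<le> (\<Sum>k<Suc n. \<bar>euler_residual (s + real k * h n) (h n) \<omega>\<bar>)" by (rule sum_abs)
      also have "\<dots> \<le> (\<Sum>k<Suc n. 2 * A * h n)"
      proof (rule sum_mono)
        fix k assume "k \<in> {..<Suc n}"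
        then have "euler_residual (s + real k * h n) (h n) \<omega> \<le> 2 * A * h n"
          using elim grid[of k n] h(1)[of n] less_imp_le by blast
        then show "\<bar>euler_residual (s + real k * h n) (h n) \<omega>\<bar> \<le> 2 * A * h n"
          by (simp add: euler_residual_def)
      qed
      also have "\<dots> = 2 * A * (real (Suc n) * h n)" by (simp del: of_nat_Suc)
      finally show ?case unfolding h(2) by simp
    qed
    show "AE \<omega> in M. (\<lambda>n. ?R n \<omega>) \<longlonglongrightarrow> 0"
      using euler_residual_uniform
    proof eventually_elim
      case (elim \<omega>)
      show ?case
      proof (rule LIMSEQ_I)
        fix e :: real assume e: "0 < e"
        define \<epsilon> where "\<epsilon> = (e / 2) / (t - s)"
        have \<epsilon>: "0 < \<epsilon>" "\<epsilon> * (t - s) < e" 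
        proof -
          show "0 < \<epsilon>" using e st by (simp add: \<epsilon>_def)
          have "\<epsilon> * (t - s) = e / 2"
            unfolding \<epsilon>_def by (rule nonzero_eq_divide_eq[THEN iffD1]) (use st in auto)
          then show "\<epsilon> * (t - s) < e" using e by simp
        qed
        obtain \<delta> where \<delta>: "0 < \<delta>" "\<And>r h. 0 \<le> r \<Longrightarrow> 0 \<le> h \<Longrightarrow> r + h \<le> T \<Longrightarrow> h < \<delta> \<Longrightarrow>
            euler_residual r h \<omega> \<le> \<epsilon> * h"
          using elim \<epsilon>(1) by blast
        obtain N where N: "\<And>n. n \<ge> N \<Longrightarrow> h n < \<delta>"
          using order_tendstoD(2)[OF hlim \<delta>(1)] unfolding eventually_sequentially by blast
        show "\<exists>N. \<forall>n\<ge>N. norm (?R n \<omega> - 0) < e"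
        proof (intro exI[of _ N] allI impI)
          fix n assume n: "n \<ge> N"
          have "\<bar>?R n \<omega>\<bar> \<le> (\<Sum>k<Suc n. \<bar>euler_residual (s + real k * h n) (h n) \<omega>\<bar>)" by (rule sum_abs)
          also have "\<dots> \<le> (\<Sum>k<Suc n. \<epsilon> * h n)"
          proof (rule sum_mono)
            fix k assume "k \<in> {..<Suc n}"
            then have "euler_residual (s + real k * h n) (h n) \<omega> \<le> \<epsilon> * h n"
              using grid[of k n] h(1)[of n] N[OF n] by (intro \<delta>(2)) auto
            then show "\<bar>euler_residual (s + real k * h n) (h n) \<omega>\<bar> \<le> \<epsilon> * h n"
              by (simp add: euler_residual_def)
          qed
          also have "\<dots> = \<epsilon> * (real (Suc n) * h n)" by (simp del: of_nat_Suc)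
          also have "\<dots> < e" unfolding h(2) by (rule \<epsilon>(2))
          finally show "norm (?R n \<omega> - 0) < e" by simp
        qed
      qed
    qed
  qed auto
  then show ?thesis by simp
qed

end

context bounded_drift_diffusion
begin

text \<open>After the centred terms are removed, the pathwise remainder of \<open>ito_step\<close> is
  integrated; \<open>1 + 3 = 4\<close> comes from the fourth moment \<open>3 * h\<^sup>2\<close> of the increment.\<close>

lemma ito_step_expectation:
  fixes g gx gxx :: "real \<Rightarrow> real \<Rightarrow> real" and Z :: "'a \<Rightarrow> real"
  assumes lip: "bdd_lipschitz T g" "bdd_lipschitz T gx" "bdd_lipschitz T gxx"
    and D: "0 \<le> D"
      "\<And>r h x \<eta> z. 0 \<le> r \<Longrightarrow> 0 < h \<Longrightarrow> r + h \<le> T \<Longrightarrow> \<bar>\<eta>\<bar> \<le> A * h \<Longrightarrow>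
      \<bar>g (r + h) (x + \<eta> + z) - g r x - z * gx r x - (z\<^sup>2 - h) * (gxx r x / 2)\<bar>
      \<le> D * \<bar>\<eta> - b x * h\<bar> + D * (h * sqrt h * (1 + z ^ 4 / h\<^sup>2))"
    and r: "0 \<le> r" "0 < h" "r + h \<le> T"
    and Z: "Z \<in> borel_measurable (F r)" "\<And>\<omega>. \<bar>Z \<omega>\<bar> \<le> 1"
  shows "\<bar>expectation (\<lambda>\<omega>. Z \<omega> * (g (r + h) (X (r + h) \<omega>) - g r (X r \<omega>)))\<bar>
    \<le> D * expectation (euler_residual r h) + 4 * D * (h * sqrt h)"
proof -
  have rT: "r \<in> {0..T}" and rhT: "r + h \<in> {r<..T}" "r + h \<in> {0..T}" using r by auto
  note [measurable] = bdd_lipschitz_measurable[OF lip(1) rT] bdd_lipschitz_measurable[OF lip(1) rhT(2)]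
    bdd_lipschitz_measurable[OF lip(2) rT] bdd_lipschitz_measurable[OF lip(3) rT]
  have XF[measurable]: "X r \<in> borel_measurable (F r)" using X_adapted rT by simp
  have [measurable]: "X r \<in> borel_measurable M" "X (r + h) \<in> borel_measurable M"
    "W r \<in> borel_measurable M" "W (r + h) \<in> borel_measurable M"
    using X_measurable W_measurable rT rhT by auto
  have ZM[measurable]: "Z \<in> borel_measurable M" using measurable_F_M[OF Z(1) rT] .
  obtain K0 where K0: "0 \<le> K0" "\<And>r x. r \<in> {0..T} \<Longrightarrow> \<bar>g r x\<bar> \<le> K0"
    by (rule bdd_lipschitzE[OF lip(1)]) blast
  obtain K2 where K2: "0 \<le> K2" "\<And>r x. r \<in> {0..T} \<Longrightarrow> \<bar>gx r x\<bar> \<le> K2"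
    by (rule bdd_lipschitzE[OF lip(2)]) blast
  obtain K3 where K3: "0 \<le> K3" "\<And>r x. r \<in> {0..T} \<Longrightarrow> \<bar>gxx r x\<bar> \<le> K3"
    by (rule bdd_lipschitzE[OF lip(3)]) blast
  let ?z = "\<lambda>\<omega>. W (r + h) \<omega> - W r \<omega>"
  let ?U = "\<lambda>\<omega>. Z \<omega> * gx r (X r \<omega>)" and ?V = "\<lambda>\<omega>. Z \<omega> * (gxx r (X r \<omega>) / 2)"
  let ?G = "\<lambda>\<omega>. Z \<omega> * (g (r + h) (X (r + h) \<omega>) - g r (X r \<omega>))"
  have U: "?U \<in> borel_measurable (F r)" "\<bar>?U \<omega>\<bar> \<le> K2" for \<omega>
    using Z(1) mult_mono[OF Z(2)[of \<omega>] K2(2)[OF rT, of "X r \<omega>"]] by (auto simp: abs_mult)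
  have V: "?V \<in> borel_measurable (F r)" "\<bar>?V \<omega>\<bar> \<le> K3" for \<omega>
  proof -
    have "\<bar>gxx r (X r \<omega>) / 2\<bar> \<le> K3" using K3(1) K3(2)[OF rT, of "X r \<omega>"] by linarith
    from mult_mono[OF Z(2)[of \<omega>] this] show "\<bar>?V \<omega>\<bar> \<le> K3"
      unfolding abs_mult[of "Z \<omega>"] by simp
  qed (use Z(1) in auto)
  have iG: "integrable M ?G"
  proof (rule integrable_const_bound[of _ "2 * K0"])
    have "\<bar>?G \<omega>\<bar> \<le> 1 * (2 * K0)" for \<omega>
      unfolding abs_mult
      using Z(2)[of \<omega>] K0(2)[OF rT, of "X r \<omega>"] K0(2)[OF rhT(2), of "X (r + h) \<omega>"]
      by (intro mult_mono) auto
    then show "AE \<omega> in M. norm (?G \<omega>) \<le> 2 * K0" by simp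
  qed measurable
  note cU = increment_centered[OF rT rhT(1) U] and cV = increment_centered[OF rT rhT(1) V]
  define e where "e \<omega> = ?G \<omega> - ?U \<omega> * ?z \<omega> - ?V \<omega> * ((?z \<omega>)\<^sup>2 - h)" for \<omega>
  have ie: "integrable M e"
    unfolding e_def using iG cU(1) cV(3) by auto
  have Ee: "expectation e = expectation ?G"
    unfolding e_def using iG cU(1,2) cV(3,4) by simp
  have iR: "integrable M (euler_residual r h)"
    using r by (intro euler_residual_integrable) auto
  have i4: "integrable M (\<lambda>\<omega>. ?z \<omega> ^ 4)" by (rule increment_moments(1)[OF rT rhT(1)])
  let ?B = "\<lambda>\<omega>. D * euler_residual r h \<omega> + D * (h * sqrt h * (1 + ?z \<omega> ^ 4 / h\<^sup>2))"
  have iB: "integrable M ?B" using iR i4 by auto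
  have "\<bar>expectation ?G\<bar> \<le> expectation (\<lambda>\<omega>. \<bar>e \<omega>\<bar>)"
    unfolding Ee[symmetric] by (rule integral_abs_bound)
  also have "\<dots> \<le> expectation ?B"
  proof (rule integral_mono_AE)
    show "AE \<omega> in M. \<bar>e \<omega>\<bar> \<le> ?B \<omega>"
      using drift_increment_bound
    proof eventually_elim
      case (elim \<omega>)
      then have \<eta>: "\<bar>drift_increment r h \<omega>\<bar> \<le> A * h" using r less_imp_le by blast
      have Xh: "X (r + h) \<omega> = X r \<omega> + drift_increment r h \<omega> + ?z \<omega>"
        by (simp add: drift_increment_def)
      let ?E = "g (r + h) (X (r + h) \<omega>) - g r (X r \<omega>) - ?z \<omega> * gx r (X r \<omega>)
         - ((?z \<omega>)\<^sup>2 - h) * (gxx r (X r \<omega>) / 2)"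
      have "e \<omega> = Z \<omega> * ?E" by (simp add: e_def algebra_simps)
      then have "\<bar>e \<omega>\<bar> = \<bar>Z \<omega>\<bar> * \<bar>?E\<bar>" by (simp only: abs_mult)
      also have "\<dots> \<le> 1 * \<bar>?E\<bar>" using Z(2) by (intro mult_right_mono) auto
      also have "1 * \<bar>?E\<bar> \<le> ?B \<omega>"
        using D(2)[OF r \<eta>, of "X r \<omega>" "?z \<omega>"] unfolding Xh[symmetric] euler_residual_def by simp
      finally show ?case .
    qed
  qed (use ie iB in auto)
  also have "\<dots> = D * expectation (euler_residual r h) + 4 * D * (h * sqrt h)"
    using iR i4 increment_moments(4)[OF rT rhT(1)] r by (simp add: prob_space)
  finally show ?thesis .
qed

text \<open>A bounded solution of the backward equation is a martingale along the diffusion. The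
  martingale identity is stated through test variables \<open>Z\<close> known at time \<open>s\<close>. Telescoping over
  \<open>Suc n\<close> steps bounds the defect by the total Euler residual plus a multiple of
  \<open>sqrt ((t - s) / Suc n)\<close>, and both tend to \<open>0\<close>.\<close>

lemma backward_solution_martingale:
  fixes g gr gx gxx :: "real \<Rightarrow> real \<Rightarrow> real" and Z :: "'a \<Rightarrow> real"
  assumes dr: "\<And>r x. ((\<lambda>r. g r x) has_real_derivative gr r x) (at r)"
    and dx: "\<And>r x. (g r has_real_derivative gx r x) (at x)"
    and dxx: "\<And>r x. (gx r has_real_derivative gxx r x) (at x)"
    and lip: "bdd_lipschitz T g" "bdd_lipschitz T gr" "bdd_lipschitz T gx" "bdd_lipschitz T gxx"
    and pde: "\<And>r x. gr r x + b x * gx r x + gxx r x / 2 = 0"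
    and st: "0 \<le> s" "s \<le> t" "t \<le> T"
    and Z: "Z \<in> borel_measurable (F s)" "\<And>\<omega>. \<bar>Z \<omega>\<bar> \<le> 1"
  shows "expectation (\<lambda>\<omega>. Z \<omega> * g t (X t \<omega>)) = expectation (\<lambda>\<omega>. Z \<omega> * g s (X s \<omega>))"
proof (cases "s = t")
  case False
  then have s_t: "s < t" using st by simp
  obtain D where D: "0 \<le> D"
    "\<And>r h x \<eta> z. 0 \<le> r \<Longrightarrow> 0 < h \<Longrightarrow> r + h \<le> T \<Longrightarrow> \<bar>\<eta>\<bar> \<le> A * h \<Longrightarrow>
      \<bar>g (r + h) (x + \<eta> + z) - g r x - z * gx r x - (z\<^sup>2 - h) * (gxx r x / 2)\<bar>
      \<le> D * \<bar>\<eta> - b x * h\<bar> + D * (h * sqrt h * (1 + z ^ 4 / h\<^sup>2))"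
    by (rule ito_step[OF dr dx dxx lip(2,3,4) pde A_nonneg horizon_nonneg]) blast
  obtain K0 where K0: "0 \<le> K0" "\<And>r x. r \<in> {0..T} \<Longrightarrow> \<bar>g r x\<bar> \<le> K0"
    by (rule bdd_lipschitzE[OF lip(1)]) blast
  have iZg: "integrable M (\<lambda>\<omega>. Z \<omega> * g r (X r \<omega>))" if r: "r \<in> {0..T}" for r
  proof (rule integrable_const_bound[of _ K0])
    have "\<bar>Z \<omega> * g r (X r \<omega>)\<bar> \<le> 1 * K0" for \<omega>
      unfolding abs_mult using Z(2)[of \<omega>] K0(2)[OF r, of "X r \<omega>"] by (intro mult_mono) auto
    then show "AE \<omega> in M. norm (Z \<omega> * g r (X r \<omega>)) \<le> K0" by simp
    have [measurable]: "Z \<in> borel_measurable M" "X r \<in> borel_measurable M" "g r \<in> borel_measurable borel"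
      using measurable_F_M[OF Z(1)] st X_measurable r bdd_lipschitz_measurable[OF lip(1)] by auto
    show "(\<lambda>\<omega>. Z \<omega> * g r (X r \<omega>)) \<in> borel_measurable M" by measurable
  qed
  define h where "h n = (t - s) / real (Suc n)" for n
  have h: "0 < h n" "real (Suc n) * h n = t - s" for n
    using s_t by (auto simp: h_def simp del: of_nat_Suc)
  have grid: "0 \<le> s + real k * h n" "s + real k * h n + h n \<le> T" if "k < Suc n" for k n
    by (rule uniform_grid_within[OF that h st(1,3)])+
  let ?R = "\<lambda>n \<omega>. \<Sum>k<Suc n. euler_residual (s + real k * h n) (h n) \<omega>"
  let ?\<Delta> = "expectation (\<lambda>\<omega>. Z \<omega> * g t (X t \<omega>)) - expectation (\<lambda>\<omega>. Z \<omega> * g s (X s \<omega>))"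
  have bound: "\<bar>?\<Delta>\<bar> \<le> D * expectation (?R n) + 4 * D * (t - s) * sqrt (h n)" for n
  proof -
    let ?r = "\<lambda>k. s + real k * h n"
    let ?G = "\<lambda>k \<omega>. Z \<omega> * g (?r k) (X (?r k) \<omega>)"
    have rT: "?r k \<in> {0..T}" if "k \<le> Suc n" for k
    proof (cases k)
      case 0 then show ?thesis using st by auto
    next
      case (Suc j)
      then show ?thesis using grid[of j n] that h(1)[of n] by (auto simp: algebra_simps)
    qed
    have rS: "?r (Suc k) = ?r k + h n" for k by (simp add: algebra_simps)
    have rn: "?r (Suc n) = t" unfolding h(2) by simp
    have "?\<Delta> = expectation (?G (Suc n)) - expectation (?G 0)"
      unfolding rn by simp
    also have "\<dots> = (\<Sum>k<Suc n. expectation (?G (Suc k)) - expectation (?G k))"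
      using sum_lessThan_telescope[of "\<lambda>k. expectation (?G k)" "Suc n"] by (rule sym)
    finally have "\<bar>?\<Delta>\<bar> = \<bar>\<Sum>k<Suc n. expectation (?G (Suc k)) - expectation (?G k)\<bar>"
      by (rule arg_cong)
    also have "\<dots> \<le> (\<Sum>k<Suc n. \<bar>expectation (?G (Suc k)) - expectation (?G k)\<bar>)"
      by (rule sum_abs)
    also have "\<dots> \<le> (\<Sum>k<Suc n. D * expectation (euler_residual (?r k) (h n)) + 4 * D * (h n * sqrt (h n)))"
    proof (rule sum_mono)
      fix k assume "k \<in> {..<Suc n}"
      then have k: "k < Suc n" by simp
      have "s \<le> ?r k" using h(1)[of n] by simp
      then have ZF: "Z \<in> borel_measurable (F (?r k))" by (rule measurable_F_mono[OF Z(1)])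
      have eq: "expectation (?G (Suc k)) - expectation (?G k)
         = expectation (\<lambda>\<omega>. Z \<omega> * (g (?r k + h n) (X (?r k + h n) \<omega>) - g (?r k) (X (?r k) \<omega>)))"
      proof -
        have i: "integrable M (?G (Suc k))" "integrable M (?G k)"
          by (rule iZg, rule rT, use k in simp)+
        show ?thesis
          by (rule trans[OF Bochner_Integration.integral_diff[OF i, symmetric]])
            (simp only: rS right_diff_distrib)
      qed
      show "\<bar>expectation (?G (Suc k)) - expectation (?G k)\<bar>
         \<le> D * expectation (euler_residual (?r k) (h n)) + 4 * D * (h n * sqrt (h n))"
        unfolding eq
        by (rule ito_step_expectation[OF lip(1,3,4) D grid(1)[OF k] h(1) grid(2)[OF k] ZF Z(2)])
    qed
    also have "\<dots> = D * expectation (?R n) + 4 * D * (t - s) * sqrt (h n)"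
    proof -
      have iR: "integrable M (euler_residual (?r k) (h n))" if k: "k < Suc n" for k
        using grid[OF k] h(1)[of n] by (intro euler_residual_integrable) auto
      have "expectation (?R n) = (\<Sum>k<Suc n. expectation (euler_residual (?r k) (h n)))"
        by (rule Bochner_Integration.integral_sum) (rule iR, simp)
      moreover have "real (Suc n) * (4 * D * (h n * sqrt (h n))) = 4 * D * (real (Suc n) * h n) * sqrt (h n)"
        by (simp only: mult_ac)
      moreover have "(\<Sum>k<Suc n. D * e k + c) = D * (\<Sum>k<Suc n. e k) + real (Suc n) * c" for e c
        by (simp only: sum.distrib sum_distrib_left sum_constant card_lessThan)
      ultimately show ?thesis by (simp only: h(2))
    qed
    finally show ?thesis .
  qed
  have hlim: "h \<longlonglongrightarrow> 0"
    unfolding h_def by (rule real_tendsto_divide_at_top[OF tendsto_const])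
      (rule filterlim_compose[OF filterlim_real_sequentially filterlim_Suc])
  have "(\<lambda>n. expectation (?R n)) \<longlonglongrightarrow> 0"
    using euler_residual_sum_tendsto_0[OF st(1) s_t st(3)] unfolding h_def .
  from tendsto_add[OF tendsto_mult[OF tendsto_const this, of D]
      tendsto_mult[OF tendsto_const tendsto_real_sqrt[OF hlim], of "4 * D * (t - s)"]]
  have "(\<lambda>n. D * expectation (?R n) + 4 * D * (t - s) * sqrt (h n)) \<longlonglongrightarrow> 0"
    by simp
  then have "\<bar>?\<Delta>\<bar> \<le> 0"
    by (intro LIMSEQ_le_const[of "\<lambda>n. D * expectation (?R n) + 4 * D * (t - s) * sqrt (h n)"])
      (use bound in auto)
  then show ?thesis by simp
qed simp

end

section \<open>The posterior of the sign and the plane waves it carries\<close>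

text \<open>If under the weight \<open>w\<close> the variable \<open>V\<close> has the characteristic function of a centred normal
  law, then \<open>V\<close> is normal under the probability with density proportional to \<open>w\<close>. The phase \<open>\<psi>\<close>
  encodes real and imaginary part at once: \<open>\<psi> = 0\<close> gives the cosine and \<open>\<psi> = - pi / 2\<close> the
  sine. Taking \<open>w\<close> to include an indicator turns the conclusion into an independence statement.\<close>

lemma (in prob_space) weighted_normal_law:
  fixes w V :: "'a \<Rightarrow> real"
  assumes w: "integrable M w" "\<And>\<omega>. 0 \<le> w \<omega>"
    and V[measurable]: "V \<in> borel_measurable M" and \<sigma>: "0 < \<sigma>"
    and cos: "\<And>\<theta> \<psi>. expectation (\<lambda>\<omega>. w \<omega> * cos (\<theta> * V \<omega> + \<psi>)) = exp (- (\<theta>\<^sup>2 * \<sigma>\<^sup>2 / 2)) * cos \<psi> * expectation w"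
    and A[measurable]: "A \<in> sets borel"
  shows "expectation (\<lambda>\<omega>. w \<omega> * indicator A (V \<omega>)) =
    expectation w * measure (density lborel (normal_density 0 \<sigma>)) A"
proof (cases "expectation w = 0")
  case True
  then have "AE \<omega> in M. w \<omega> = 0"
    using integral_nonneg_eq_0_iff_AE[OF w(1)] w(2) by simp
  then have "AE \<omega> in M. w \<omega> * indicator A (V \<omega>) = 0"
    by eventually_elim simp
  then show ?thesis unfolding True by (simp add: integral_eq_zero_AE)
next
  case False
  have [measurable]: "w \<in> borel_measurable M" using w(1) by auto
  let ?m = "expectation w"
  have m: "0 < ?m" using False w(2) by (simp add: less_le)
  define U where "U = density M (\<lambda>\<omega>. ennreal (w \<omega> / ?m))"
  have [measurable_cong]: "sets U = sets M" and spU: "space U = space M" by (auto simp: U_def)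
  have intU: "(\<integral>\<omega>. f \<omega> \<partial>U) = (\<integral>\<omega>. w \<omega> * f \<omega> \<partial>M) / ?m"
    if [measurable]: "f \<in> borel_measurable M" for f :: "'a \<Rightarrow> real"
    unfolding U_def using w(2) m by (subst integral_real_density) auto
  have "emeasure U (space U) = (\<integral>\<^sup>+\<omega>. ennreal (w \<omega> / ?m) \<partial>M)"
    unfolding U_def by (simp add: emeasure_density cong: nn_integral_cong)
  also have "\<dots> = ennreal (\<integral>\<omega>. w \<omega> / ?m \<partial>M)"
    using w m by (intro nn_integral_eq_integral) auto
  also have "\<dots> = 1" using m by simp
  finally interpret U: prob_space U by (rule prob_spaceI)
  have char: "char (distr U borel (\<lambda>\<omega>. V \<omega> / \<sigma>)) t = char std_normal_distribution t" for t
  proof -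
    have i: "integrable U (\<lambda>\<omega>. iexp (t * (V \<omega> / \<sigma>)))"
      by (rule U.integrable_const_bound[of _ 1]) auto
    have "char (distr U borel (\<lambda>\<omega>. V \<omega> / \<sigma>)) t = (CLINT \<omega>|U. iexp (t * (V \<omega> / \<sigma>)))"
      unfolding char_def by (subst integral_distr) auto
    also have "\<dots> = complex_of_real (exp (- (t\<^sup>2) / 2))"
    proof (rule complex_eqI)
      have "Re (CLINT \<omega>|U. iexp (t * (V \<omega> / \<sigma>))) = (\<integral>\<omega>. cos (t / \<sigma> * V \<omega> + 0) \<partial>U)"
        using i by (subst integral_Re[symmetric]) (auto simp: Re_exp)
      then show "Re (CLINT \<omega>|U. iexp (t * (V \<omega> / \<sigma>))) = Re (complex_of_real (exp (- (t\<^sup>2) / 2)))"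
        using cos[of "t / \<sigma>" 0] m \<sigma> by (subst (asm) intU) (auto simp: power_divide)
      have "Im (CLINT \<omega>|U. iexp (t * (V \<omega> / \<sigma>))) = (\<integral>\<omega>. cos (t / \<sigma> * V \<omega> + (- (pi / 2))) \<partial>U)"
        using i by (subst integral_Im[symmetric]) (auto simp: Im_exp cos_diff)
      then show "Im (CLINT \<omega>|U. iexp (t * (V \<omega> / \<sigma>))) = Im (complex_of_real (exp (- (t\<^sup>2) / 2)))"
        using cos[of "t / \<sigma>" "- (pi / 2)"] m \<sigma> by (subst (asm) intU) auto
    qed
    finally show ?thesis by (simp add: char_std_normal_distribution)
  qed
  have "distr U borel (\<lambda>\<omega>. V \<omega> / \<sigma>) = std_normal_distribution"
    by (rule Levy_uniqueness)
      (auto simp: char fun_eq_iff real_dist_normal_dist intro!: U.real_distribution_distr)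
  then have "distributed U lborel (\<lambda>\<omega>. (V \<omega> - 0) / \<sigma>) std_normal_density"
    unfolding distributed_def by (simp cong: distr_cong)
  then have "distributed U lborel V (normal_density 0 \<sigma>)"
    using U.normal_standard_normal_convert[OF \<sigma>, of V 0] by simp
  then have law: "distr U lborel V = density lborel (normal_density 0 \<sigma>)"
    by (rule distributed_distr_eq_density)
  have "measure (density lborel (normal_density 0 \<sigma>)) A = U.prob (V -` A \<inter> space U)"
    unfolding law[symmetric] by (subst measure_distr) auto
  also have "\<dots> = (\<integral>\<omega>. indicator A (V \<omega>) \<partial>U)"
  proof -
    have "(\<integral>\<omega>. indicator A (V \<omega>) \<partial>U) = (\<integral>\<omega>. (indicator (V -` A \<inter> space U) \<omega> :: real) \<partial>U)"
      by (intro Bochner_Integration.integral_cong) (auto simp: indicator_def)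
    then show ?thesis by simp
  qed
  also have "\<dots> = expectation (\<lambda>\<omega>. w \<omega> * indicator A (V \<omega>)) / ?m"
    by (rule intU) measurable
  finally show ?thesis using m by (simp add: field_simps)
qed

text \<open>The probability that the drift of a process \<open>B t + V\<^sub>t\<close> is \<open>a\<close>, given its current position
  \<open>x\<close>, when \<open>B = \<plusminus>a\<close> are equally likely: the logistic function
  \<open>exp (a * x) / (exp (a * x) + exp (- (a * x)))\<close>.\<close>

definition sign_posterior :: "real \<Rightarrow> real \<Rightarrow> real" where
  "sign_posterior a x = (1 + tanh (a * x)) / 2"

lemma sign_posterior_bounds: "0 < sign_posterior a x" "sign_posterior a x < 1"
  using tanh_real_bounds[of "a * x"] by (auto simp: sign_posterior_def)

lemma sign_posterior_uminus: "sign_posterior (- a) x = 1 - sign_posterior a x"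
  by (simp add: sign_posterior_def field_simps)

lemma sign_posterior_measurable [measurable]: "sign_posterior a \<in> borel_measurable borel"
proof -
  have "continuous_on UNIV (sign_posterior a)"
    unfolding sign_posterior_def[abs_def] by (intro continuous_intros) auto
  then show ?thesis by (rule borel_measurable_continuous_onI)
qed

text \<open>The plane wave \<open>cos (\<theta> * (x - a * r) + \<phi>)\<close>, moving with speed \<open>a\<close> and amplified at the rate at
  which Brownian motion damps it, is the martingale that characterises Brownian motion with
  drift \<open>a\<close>. The factor \<open>sign_posterior a\<close> transports it to the diffusion with drift
  \<open>a * tanh (a * x)\<close>.\<close>

definition wave :: "real \<Rightarrow> real \<Rightarrow> real \<Rightarrow> real \<Rightarrow> real \<Rightarrow> real" where
  "wave a \<theta> \<phi> r x = exp (\<theta>\<^sup>2 / 2 * r) * (cos (- (\<theta> * a) * r + \<theta> * x + \<phi>) * sign_posterior a x)"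

text \<open>Write \<open>H = tanh (a * x)\<close> and \<open>q\<close> for the posterior. Two identities make the equation hold:
  \<open>q\<close> itself is harmonic, \<open>a * H * q' + q'' / 2 = 0\<close>, and \<open>a * (1 - H) * q = q'\<close>, which says that
  multiplication by \<open>q\<close> changes the drift from \<open>a * H\<close> to \<open>a\<close>.\<close>

lemma wave_backward_equation:
  obtains gr gx gxx where
    "\<And>r x. ((\<lambda>r. wave a \<theta> \<phi> r x) has_real_derivative gr r x) (at r)"
    "\<And>r x. (wave a \<theta> \<phi> r has_real_derivative gx r x) (at x)"
    "\<And>r x. (gx r has_real_derivative gxx r x) (at x)"
    "bdd_lipschitz T (wave a \<theta> \<phi>)" "bdd_lipschitz T gr" "bdd_lipschitz T gx" "bdd_lipschitz T gxx"
    "\<And>r x. gr r x + a * tanh (a * x) * gx r x + gxx r x / 2 = 0"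
proof -
  define e where "e r = exp (\<theta>\<^sup>2 / 2 * r)" for r :: real
  define C where "C r x = cos (- (\<theta> * a) * r + \<theta> * x + \<phi>)" for r x
  define S where "S r x = sin (- (\<theta> * a) * r + \<theta> * x + \<phi>)" for r x
  define H where "H x = tanh (a * x)" for x
  \<comment> \<open>Everything is written with \<open>+\<close> and \<open>*\<close> only, the form in which \<open>bdd_lipschitz_intros\<close> applies.\<close>
  define q where "q x = 1 / 2 + 1 / 2 * H x" for x
  define q' where "q' x = a / 2 + (- (a / 2)) * (H x * H x)" for x
  define gr where "gr r x = e r * (\<theta>\<^sup>2 / 2 * (C r x * q x) + \<theta> * a * (S r x * q x))" for r x
  define gx where "gx r x = e r * (- \<theta> * (S r x * q x) + C r x * q' x)" for r x
  define gxx where "gxx r x = e r * (- (\<theta>\<^sup>2) * (C r x * q x) + (- 2 * \<theta>) * (S r x * q' x)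
     + (- 2 * a) * (C r x * (H x * q' x)))" for r x
  have g: "wave a \<theta> \<phi> r x = e r * (C r x * q x)" for r x
    by (simp add: wave_def sign_posterior_def e_def C_def q_def H_def add_divide_distrib)
  have de: "(e has_real_derivative \<theta>\<^sup>2 / 2 * e r) (at r)" for r
    unfolding e_def by (auto intro!: derivative_eq_intros)
  have dCr: "((\<lambda>r. C r x) has_real_derivative \<theta> * a * S r x) (at r)" for r x
    unfolding C_def S_def by (auto intro!: derivative_eq_intros)
  have dCx: "(C r has_real_derivative - \<theta> * S r x) (at x)" for r x
    unfolding C_def S_def by (auto intro!: derivative_eq_intros)
  have dSx: "(S r has_real_derivative \<theta> * C r x) (at x)" for r x
    unfolding C_def S_def by (auto intro!: derivative_eq_intros)
  have dH: "(H has_real_derivative 2 * q' x) (at x)" for x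
    unfolding H_def q'_def by (auto intro!: derivative_eq_intros simp: power2_eq_square algebra_simps)
  have dq: "(q has_real_derivative q' x) (at x)" for x
    unfolding q_def by (auto intro!: derivative_eq_intros dH)
  have dq': "(q' has_real_derivative - 2 * a * (H x * q' x)) (at x)" for x
    unfolding q'_def[abs_def]
    by (rule derivative_eq_intros dH refl)+ (simp add: q'_def algebra_simps)
  have "((\<lambda>r. wave a \<theta> \<phi> r x) has_real_derivative gr r x) (at r)" for r x
    unfolding g gr_def by (rule derivative_eq_intros de dCr refl)+ (simp add: algebra_simps)
  moreover have "(wave a \<theta> \<phi> r has_real_derivative gx r x) (at x)" for r x
    unfolding g[abs_def] gx_def by (rule derivative_eq_intros dCx dq refl)+ (simp add: algebra_simps)
  moreover have "(gx r has_real_derivative gxx r x) (at x)" for r x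
    unfolding gxx_def gx_def[abs_def]
    by (rule derivative_eq_intros dCx dSx dq dq' refl)+ (simp add: algebra_simps power2_eq_square)
  moreover have "bdd_lipschitz T (wave a \<theta> \<phi>)" "bdd_lipschitz T gr" "bdd_lipschitz T gx" "bdd_lipschitz T gxx"
    unfolding g[abs_def] gr_def[abs_def] gx_def[abs_def] gxx_def[abs_def] q_def q'_def e_def C_def S_def H_def
    by (intro bdd_lipschitz_intros; simp)+
  moreover have "gr r x + a * tanh (a * x) * gx r x + gxx r x / 2 = 0" for r x
    unfolding gr_def gx_def gxx_def H_def[symmetric] q_def q'_def
    by (simp add: field_simps power2_eq_square)
  ultimately show ?thesis by (rule that)
qed

section \<open>Change of measure for the tanh drift\<close>

locale tanh_diffusion = brownian M F T W
  for M :: "'a measure" and F T W +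
  fixes a x0 :: real and X :: "real \<Rightarrow> 'a \<Rightarrow> real"
  assumes tanh_solution: "sde_solution M F T x0 (\<lambda>x _. a * tanh (a * x)) W X"
begin

sublocale bounded_drift_diffusion M F T W x0 "\<lambda>x. a * tanh (a * x)" X "\<bar>a\<bar>"
proof
  show "sde_solution M F T x0 (\<lambda>x _. a * tanh (a * x)) W X" by (fact tanh_solution)
  show "continuous_on UNIV (\<lambda>x. a * tanh (a * x))" by (intro continuous_intros) auto
  show "\<bar>a * tanh (a * x)\<bar> \<le> \<bar>a\<bar>" for x
    using mult_left_mono[OF abs_tanh_le_1[of "a * x"], of "\<bar>a\<bar>"] by (simp add: abs_mult)
qed

lemma wave_martingale:
  assumes "0 \<le> s" "s \<le> t" "t \<le> T" "Z \<in> borel_measurable (F s)" "\<And>\<omega>. \<bar>Z \<omega>\<bar> \<le> 1"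
  shows "expectation (\<lambda>\<omega>. Z \<omega> * wave a \<theta> \<phi> t (X t \<omega>)) = expectation (\<lambda>\<omega>. Z \<omega> * wave a \<theta> \<phi> s (X s \<omega>))"
proof -
  obtain gr gx gxx where g:
    "\<And>r x. ((\<lambda>r. wave a \<theta> \<phi> r x) has_real_derivative gr r x) (at r)"
    "\<And>r x. (wave a \<theta> \<phi> r has_real_derivative gx r x) (at x)"
    "\<And>r x. (gx r has_real_derivative gxx r x) (at x)"
    "bdd_lipschitz T (wave a \<theta> \<phi>)" "bdd_lipschitz T gr" "bdd_lipschitz T gx" "bdd_lipschitz T gxx"
    "\<And>r x. gr r x + a * tanh (a * x) * gx r x + gxx r x / 2 = 0"
    by (rule wave_backward_equation[of a \<theta> \<phi> T]) blast
  show ?thesis by (rule backward_solution_martingale[OF g assms])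
qed

lemma posterior_martingale:
  assumes "0 \<le> s" "s \<le> t" "t \<le> T" "Z \<in> borel_measurable (F s)" "\<And>\<omega>. \<bar>Z \<omega>\<bar> \<le> 1"
  shows "expectation (\<lambda>\<omega>. Z \<omega> * sign_posterior a (X t \<omega>)) = expectation (\<lambda>\<omega>. Z \<omega> * sign_posterior a (X s \<omega>))"
  using wave_martingale[OF assms, of 0 0] by (simp add: wave_def)

lemma posterior_start: "expectation (\<lambda>\<omega>. sign_posterior a (X T \<omega>)) = sign_posterior a x0"
proof -
  have "expectation (\<lambda>\<omega>. sign_posterior a (X T \<omega>)) = expectation (\<lambda>\<omega>. sign_posterior a (X 0 \<omega>))"
    using posterior_martingale[of 0 T "\<lambda>_. 1"] horizon_nonneg by simp
  also have "\<dots> = expectation (\<lambda>\<omega>. sign_posterior a x0)"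
  proof (rule integral_cong_AE)
    show "AE \<omega> in M. sign_posterior a (X 0 \<omega>) = sign_posterior a x0"
      using X_start by eventually_elim simp
    have [measurable]: "X 0 \<in> borel_measurable M" using X_measurable horizon_nonneg by simp
    show "(\<lambda>\<omega>. sign_posterior a (X 0 \<omega>)) \<in> borel_measurable M" by measurable
  qed auto
  finally show ?thesis by (simp add: prob_space)
qed

text \<open>The wave martingale, started with a phase known at time \<open>s\<close>, gives the characteristic
  function of the increment of \<open>X\<^sub>r - a r\<close> under the weight \<open>q (X\<^sub>T)\<close>, conditionally on \<open>F s\<close>.
  The random phase is brought to the fixed phases \<open>0\<close> and \<open>- pi / 2\<close> by the addition theorem
  for the cosine; the weight moves from time \<open>T\<close> to time \<open>t\<close> and from \<open>s\<close> back to \<open>T\<close> because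
  the posterior is a martingale.\<close>

lemma increment_wave:
  assumes s: "s \<in> {0..T}" and t: "t \<in> {s<..T}" and D: "D \<in> sets (F s)"
  shows "expectation (\<lambda>\<omega>. indicator D \<omega> * sign_posterior a (X T \<omega>) *
            cos (\<theta> * ((X t \<omega> - a * t) - (X s \<omega> - a * s)) + \<psi>)) =
     exp (- (\<theta>\<^sup>2 * (t - s) / 2)) * cos \<psi> * expectation (\<lambda>\<omega>. indicator D \<omega> * sign_posterior a (X T \<omega>))"
proof -
  have st: "0 \<le> s" "s \<le> t" "t \<le> T" "t \<in> {0..T}" "s \<le> T" "0 \<le> t" using s t by auto
  let ?u = "\<lambda>r \<omega>. \<theta> * (X r \<omega> - a * r)"
  let ?q = "\<lambda>r \<omega>. sign_posterior a (X r \<omega>)"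
  have DF[measurable]: "D \<in> sets (F s)" "D \<in> sets (F t)" "D \<in> sets M"
    using D sets_F_mono[OF st(2)] sets_F_le[OF s] by auto
  have [measurable]: "X s \<in> borel_measurable (F s)" "X s \<in> borel_measurable (F t)"
     "X t \<in> borel_measurable (F t)" "X s \<in> borel_measurable M" "X t \<in> borel_measurable M"
    using X_adapted s st measurable_F_mono[OF X_adapted[OF s] st(2)] X_measurable by auto
  let ?cs = "\<lambda>\<omega>. indicator D \<omega> * cos (?u s \<omega> - \<psi>)" and ?sn = "\<lambda>\<omega>. indicator D \<omega> * sin (?u s \<omega> - \<psi>)"
  have bnd: "\<bar>indicator D \<omega> * cos y\<bar> \<le> 1" "\<bar>indicator D \<omega> * sin y\<bar> \<le> 1" for \<omega> and y :: real
    by (auto simp: indicator_def)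
  have W0: "wave a \<theta> 0 r x = exp (\<theta>\<^sup>2 / 2 * r) * (cos (\<theta> * (x - a * r)) * sign_posterior a x)"
    and W1: "wave a \<theta> (- (pi / 2)) r x = exp (\<theta>\<^sup>2 / 2 * r) * (sin (\<theta> * (x - a * r)) * sign_posterior a x)" for r x
  proof -
    have "- (\<theta> * a) * r + \<theta> * x = \<theta> * (x - a * r)" by (simp add: algebra_simps)
    moreover have "cos (y - pi / 2) = sin y" for y :: real by (simp add: cos_diff)
    ultimately show "wave a \<theta> 0 r x = exp (\<theta>\<^sup>2 / 2 * r) * (cos (\<theta> * (x - a * r)) * sign_posterior a x)"
     "wave a \<theta> (- (pi / 2)) r x = exp (\<theta>\<^sup>2 / 2 * r) * (sin (\<theta> * (x - a * r)) * sign_posterior a x)"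
      unfolding wave_def by simp_all
  qed
  have i: "integrable M (\<lambda>\<omega>. indicator D \<omega> * f \<omega> * ?q r \<omega>)"
    if [measurable]: "f \<in> borel_measurable M" and f: "\<And>\<omega>. \<bar>f \<omega>\<bar> \<le> 1" and r: "r \<in> {0..T}" for f r
  proof (rule integrable_const_bound[of _ 1])
    have [measurable]: "X r \<in> borel_measurable M" using X_measurable r .
    show "(\<lambda>\<omega>. indicator D \<omega> * f \<omega> * ?q r \<omega>) \<in> borel_measurable M" by measurable
    have "\<bar>f \<omega> * ?q r \<omega>\<bar> \<le> 1 * 1" for \<omega>
      unfolding abs_mult using f[of \<omega>] sign_posterior_bounds[of a "X r \<omega>"] by (intro mult_mono) auto
    then show "AE \<omega> in M. norm (indicator D \<omega> * f \<omega> * ?q r \<omega>) \<le> 1"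
      by (auto simp: indicator_def)
  qed
  have prod_le: "\<bar>cos x * cos y\<bar> \<le> 1" "\<bar>sin x * sin y\<bar> \<le> 1" for x y :: real
    unfolding abs_mult using mult_mono[of "\<bar>cos x\<bar>" 1 "\<bar>cos y\<bar>" 1] mult_mono[of "\<bar>sin x\<bar>" 1 "\<bar>sin y\<bar>" 1] by auto
  have ic: "integrable M (\<lambda>\<omega>. indicator D \<omega> * (cos (?u s \<omega> - \<psi>) * cos (?u r \<omega>)) * ?q r \<omega>)"
    and isn: "integrable M (\<lambda>\<omega>. indicator D \<omega> * (sin (?u s \<omega> - \<psi>) * sin (?u r \<omega>)) * ?q r \<omega>)"
    if "r \<in> {s, t}" for r
  proof -
    have r: "r \<in> {0..T}" and [measurable]: "X r \<in> borel_measurable M" using that s st X_measurable by auto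
    show "integrable M (\<lambda>\<omega>. indicator D \<omega> * (cos (?u s \<omega> - \<psi>) * cos (?u r \<omega>)) * ?q r \<omega>)"
      "integrable M (\<lambda>\<omega>. indicator D \<omega> * (sin (?u s \<omega> - \<psi>) * sin (?u r \<omega>)) * ?q r \<omega>)"
      using r prod_le by (auto intro!: i)
  qed
  have mc: "exp (\<theta>\<^sup>2 / 2 * t) * expectation (\<lambda>\<omega>. indicator D \<omega> * (cos (?u s \<omega> - \<psi>) * cos (?u t \<omega>)) * ?q t \<omega>)
     = exp (\<theta>\<^sup>2 / 2 * s) * expectation (\<lambda>\<omega>. indicator D \<omega> * (cos (?u s \<omega> - \<psi>) * cos (?u s \<omega>)) * ?q s \<omega>)"
    using wave_martingale[OF st(1,2,3), of ?cs \<theta> 0] bnd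
    unfolding W0 Bochner_Integration.integral_mult_right_zero[symmetric] by (simp add: mult_ac)
  have ms: "exp (\<theta>\<^sup>2 / 2 * t) * expectation (\<lambda>\<omega>. indicator D \<omega> * (sin (?u s \<omega> - \<psi>) * sin (?u t \<omega>)) * ?q t \<omega>)
     = exp (\<theta>\<^sup>2 / 2 * s) * expectation (\<lambda>\<omega>. indicator D \<omega> * (sin (?u s \<omega> - \<psi>) * sin (?u s \<omega>)) * ?q s \<omega>)"
    using wave_martingale[OF st(1,2,3), of ?sn \<theta> "- (pi / 2)"] bnd
    unfolding W1 Bochner_Integration.integral_mult_right_zero[symmetric] by (simp add: mult_ac)
  have split: "indicator D \<omega> * cos (?u r \<omega> - (?u s \<omega> - \<psi>)) * ?q r \<omega>
      = indicator D \<omega> * (cos (?u s \<omega> - \<psi>) * cos (?u r \<omega>)) * ?q r \<omega>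
      + indicator D \<omega> * (sin (?u s \<omega> - \<psi>) * sin (?u r \<omega>)) * ?q r \<omega>" for r \<omega>
    unfolding cos_diff[of "?u r \<omega>"] by (simp add: algebra_simps)
  have "exp (\<theta>\<^sup>2 / 2 * t) * expectation (\<lambda>\<omega>. indicator D \<omega> * cos (?u t \<omega> - (?u s \<omega> - \<psi>)) * ?q t \<omega>)
      = exp (\<theta>\<^sup>2 / 2 * s) * expectation (\<lambda>\<omega>. indicator D \<omega> * cos (?u s \<omega> - (?u s \<omega> - \<psi>)) * ?q s \<omega>)"
    unfolding split using mc ms ic isn by (simp add: distrib_left)
  also have "(\<lambda>\<omega>. indicator D \<omega> * cos (?u s \<omega> - (?u s \<omega> - \<psi>)) * ?q s \<omega>) = (\<lambda>\<omega>. cos \<psi> * (indicator D \<omega> * ?q s \<omega>))"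
    by (simp add: mult_ac)
  also have "expectation (\<lambda>\<omega>. cos \<psi> * (indicator D \<omega> * ?q s \<omega>)) = cos \<psi> * expectation (\<lambda>\<omega>. indicator D \<omega> * ?q s \<omega>)"
    by simp
  also have "expectation (\<lambda>\<omega>. indicator D \<omega> * ?q s \<omega>) = expectation (\<lambda>\<omega>. indicator D \<omega> * ?q T \<omega>)"
    using posterior_martingale[of s T "indicator D"] st by (simp add: indicator_def)
  finally have main: "exp (\<theta>\<^sup>2 / 2 * t) * expectation (\<lambda>\<omega>. indicator D \<omega> * cos (?u t \<omega> - (?u s \<omega> - \<psi>)) * ?q t \<omega>)
     = exp (\<theta>\<^sup>2 / 2 * s) * (cos \<psi> * expectation (\<lambda>\<omega>. indicator D \<omega> * ?q T \<omega>))" .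
  have "expectation (\<lambda>\<omega>. indicator D \<omega> * ?q T \<omega> * cos (\<theta> * ((X t \<omega> - a * t) - (X s \<omega> - a * s)) + \<psi>))
      = expectation (\<lambda>\<omega>. (indicator D \<omega> * cos (?u t \<omega> - (?u s \<omega> - \<psi>))) * ?q T \<omega>)"
    by (intro Bochner_Integration.integral_cong) (auto simp: algebra_simps)
  also have "\<dots> = expectation (\<lambda>\<omega>. (indicator D \<omega> * cos (?u t \<omega> - (?u s \<omega> - \<psi>))) * ?q t \<omega>)"
    using st by (intro posterior_martingale bnd) auto
  also have "\<dots> = exp (- (\<theta>\<^sup>2 / 2 * t)) * (exp (\<theta>\<^sup>2 / 2 * s) * (cos \<psi> * expectation (\<lambda>\<omega>. indicator D \<omega> * ?q T \<omega>)))"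
    unfolding main[symmetric] by (simp add: exp_minus field_simps)
  also have "\<dots> = (exp (- (\<theta>\<^sup>2 / 2 * t)) * exp (\<theta>\<^sup>2 / 2 * s)) * (cos \<psi> * expectation (\<lambda>\<omega>. indicator D \<omega> * ?q T \<omega>))"
    by (simp only: mult.assoc)
  also have "exp (- (\<theta>\<^sup>2 / 2 * t)) * exp (\<theta>\<^sup>2 / 2 * s) = exp (- (\<theta>\<^sup>2 * (t - s) / 2))"
    unfolding exp_add[symmetric] by (simp add: algebra_simps diff_divide_distrib)
  finally show ?thesis by (simp only: mult.assoc)
qed

text \<open>The law of the experiment conditioned on the drift being \<open>a\<close>: Bayes' rule gives it the
  density posterior over prior.\<close>

definition tilted :: "'a measure" where
  "tilted = density M (\<lambda>\<omega>. ennreal (sign_posterior a (X T \<omega>) / sign_posterior a x0))"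

lemma sets_tilted [simp, measurable_cong]: "sets tilted = sets M"
  and space_tilted [simp]: "space tilted = space M"
  by (simp_all add: tilted_def)

lemma X_T_measurable [measurable]: "X T \<in> borel_measurable M"
  using X_measurable horizon_nonneg by simp

lemma posterior_weight_integrable:
  assumes "S \<in> sets M"
  shows "integrable M (\<lambda>\<omega>. indicator S \<omega> * sign_posterior a (X T \<omega>))"
proof (rule integrable_const_bound[of _ 1])
  show "AE \<omega> in M. norm (indicator S \<omega> * sign_posterior a (X T \<omega>)) \<le> 1"
    using sign_posterior_bounds[of a] by (auto simp: indicator_def less_imp_le abs_of_pos)
qed (use assms in measurable)

lemma emeasure_tilted:
  assumes S[measurable]: "S \<in> sets M"
  shows "emeasure tilted S =
    ennreal (expectation (\<lambda>\<omega>. indicator S \<omega> * sign_posterior a (X T \<omega>)) / sign_posterior a x0)"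
proof -
  have nn: "0 \<le> indicator S \<omega> * sign_posterior a (X T \<omega>) / sign_posterior a x0" for \<omega>
    using sign_posterior_bounds[of a] by (simp add: less_imp_le)
  have "emeasure tilted S = (\<integral>\<^sup>+\<omega>. ennreal (indicator S \<omega> * sign_posterior a (X T \<omega>) / sign_posterior a x0) \<partial>M)"
    unfolding tilted_def
    by (subst emeasure_density) (auto intro!: nn_integral_cong simp: indicator_def)
  also have "\<dots> = ennreal (expectation (\<lambda>\<omega>. indicator S \<omega> * sign_posterior a (X T \<omega>) / sign_posterior a x0))"
    using posterior_weight_integrable[OF S] nn by (intro nn_integral_eq_integral) auto
  finally show ?thesis by simp
qed

lemma prob_space_tilted: "prob_space tilted"
proof
  have "expectation (\<lambda>\<omega>. indicator (space M) \<omega> * sign_posterior a (X T \<omega>)) = sign_posterior a x0"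
    unfolding posterior_start[symmetric] by (intro Bochner_Integration.integral_cong) auto
  then show "emeasure tilted (space tilted) = 1"
    using sign_posterior_bounds(1)[of a x0] by (simp add: emeasure_tilted)
qed

lemma measure_tilted:
  assumes S: "S \<in> sets M"
  shows "measure tilted S = expectation (\<lambda>\<omega>. indicator S \<omega> * sign_posterior a (X T \<omega>)) / sign_posterior a x0"
  unfolding measure_def emeasure_tilted[OF S]
  using sign_posterior_bounds(1)[of a] by (intro enn2real_ennreal divide_nonneg_pos integral_nonneg_AE) (auto simp: less_imp_le)

definition driftless :: "real \<Rightarrow> 'a \<Rightarrow> real" where
  "driftless t \<omega> = X t \<omega> - x0 - a * t"

lemma driftless_adapted: "t \<in> {0..T} \<Longrightarrow> driftless t \<in> borel_measurable (F t)"
  unfolding driftless_def[abs_def] using X_adapted by measurable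

lemma tilted_increment_law:
  assumes s: "s \<in> {0..T}" and t: "t \<in> {s<..T}" and D: "D \<in> sets (F s)" and A: "A \<in> sets borel"
  shows "measure tilted (D \<inter> ((\<lambda>\<omega>. driftless t \<omega> - driftless s \<omega>) -` A \<inter> space M)) =
    measure tilted D * measure (density lborel (normal_density 0 (sqrt (t - s)))) A"
proof -
  have ts: "t \<in> {0..T}" using s t by auto
  have DM: "D \<in> sets M" using D sets_F_le[OF s] by auto
  let ?w = "\<lambda>\<omega>. indicator D \<omega> * sign_posterior a (X T \<omega>)"
  let ?V = "\<lambda>\<omega>. driftless t \<omega> - driftless s \<omega>"
  have V: "?V \<omega> = (X t \<omega> - a * t) - (X s \<omega> - a * s)" for \<omega>
    by (auto simp: driftless_def)
  have [measurable]: "driftless t \<in> borel_measurable M" "driftless s \<in> borel_measurable M"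
    using measurable_F_M[OF driftless_adapted] s ts by auto
  have E[measurable]: "?V -` A \<inter> space M \<in> sets M"
    using A by (intro measurable_sets[of ?V M borel]) auto
  have "expectation (\<lambda>\<omega>. ?w \<omega> * indicator A (?V \<omega>)) =
     expectation ?w * measure (density lborel (normal_density 0 (sqrt (t - s)))) A"
  proof (rule weighted_normal_law)
    show "integrable M ?w" by (rule posterior_weight_integrable[OF DM])
    show "0 \<le> ?w \<omega>" for \<omega> using sign_posterior_bounds[of a] by (simp add: less_imp_le)
    show "expectation (\<lambda>\<omega>. ?w \<omega> * cos (\<theta> * ?V \<omega> + \<psi>)) =
       exp (- (\<theta>\<^sup>2 * (sqrt (t - s))\<^sup>2 / 2)) * cos \<psi> * expectation ?w" for \<theta> \<psi>
      using increment_wave[OF s t D, of \<theta> \<psi>] t unfolding V by simp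
  qed (use t A in auto)
  moreover have "expectation (\<lambda>\<omega>. ?w \<omega> * indicator A (?V \<omega>)) =
     expectation (\<lambda>\<omega>. indicator (D \<inter> (?V -` A \<inter> space M)) \<omega> * sign_posterior a (X T \<omega>))"
    by (intro Bochner_Integration.integral_cong) (auto simp: indicator_def)
  ultimately show ?thesis
    using DM by (simp add: measure_tilted)
qed

text \<open>Girsanov's theorem for this change of measure.\<close>

lemma brownian_tilted: "brownian tilted F T driftless"
proof
  interpret Q: prob_space tilted by (rule prob_space_tilted)
  have AEQ: "AE \<omega> in tilted. P \<omega>" if "AE \<omega> in M. P \<omega>" for P
    using that unfolding tilted_def by (subst AE_density) auto
  have incr: "Q.indep_set (sets (F s))
          {(\<lambda>\<omega>. driftless t \<omega> - driftless s \<omega>) -` A \<inter> space tilted | A. A \<in> sets borel} \<and>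
        distributed tilted lborel (\<lambda>\<omega>. driftless t \<omega> - driftless s \<omega>) (normal_density 0 (sqrt (t - s)))"
    if s: "s \<in> {0..T}" and t: "t \<in> {s<..T}" for s t
  proof -
    let ?V = "\<lambda>\<omega>. driftless t \<omega> - driftless s \<omega>"
    let ?N = "density lborel (normal_density 0 (sqrt (t - s)))"
    interpret N: prob_space ?N using t by (intro prob_space_normal_density) simp
    have [measurable]: "driftless t \<in> borel_measurable M" "driftless s \<in> borel_measurable M"
      using measurable_F_M[OF driftless_adapted] s t by auto
    have V: "Q.prob (?V -` A \<inter> space M) = measure ?N A" if "A \<in> sets borel" for A
      using tilted_increment_law[OF s t sets.top that] Q.prob_space
      by (simp add: space_F Int_assoc[symmetric] Int_commute)
    have E: "?V -` A \<inter> space M \<in> sets M" if "A \<in> sets borel" for A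
      using that by (intro measurable_sets[of ?V M borel]) auto
    have "Q.indep_set (sets (F s)) {?V -` A \<inter> space tilted | A. A \<in> sets borel}"
      using sets_F_le[OF s] E
      by (intro Q.indep_setI) (auto simp: tilted_increment_law[OF s t] V)
    moreover have "distr tilted lborel ?V = ?N"
      using V by (intro measure_eqI)
        (auto simp: emeasure_distr Q.emeasure_eq_measure N.emeasure_eq_measure)
    ultimately show ?thesis by (auto simp: distributed_def)
  qed
  show "brownian_motion tilted F T driftless"
    unfolding brownian_motion_def
  proof (intro conjI ballI)
    show "prob_space tilted" by (rule prob_space_tilted)
    show "filtration (space tilted) F" using brownian_motion by (simp add: brownian_motion_def)
    show "subalgebra tilted (F t)" if "t \<in> {0..T}" for t
      using sets_F_le[OF that] by (simp add: subalgebra_def space_F)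
    show "AE \<omega> in tilted. driftless 0 \<omega> = 0"
      by (rule AEQ) (use X_start in \<open>eventually_elim, simp add: driftless_def\<close>)
    show "AE \<omega> in tilted. continuous_on {0..T} (\<lambda>t. driftless t \<omega>)"
      by (rule AEQ) (use X_continuous in \<open>eventually_elim, auto simp: driftless_def intro!: continuous_intros\<close>)
  qed (use incr driftless_adapted in auto)
qed (fact horizon_nonneg)

lemma emeasure_tilted_weighted:
  assumes "S \<in> sets M"
  shows "ennreal (sign_posterior a x0) * emeasure tilted S =
    ennreal (expectation (\<lambda>\<omega>. indicator S \<omega> * sign_posterior a (X T \<omega>)))"
proof -
  have "0 \<le> expectation (\<lambda>\<omega>. indicator S \<omega> * sign_posterior a (X T \<omega>)) / sign_posterior a x0"
    using sign_posterior_bounds(1)[of a] by (intro divide_nonneg_pos integral_nonneg_AE) (auto simp: less_imp_le)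
  then show ?thesis
    unfolding emeasure_tilted[OF assms]
    using sign_posterior_bounds(1)[of a x0] by (simp add: ennreal_mult'[symmetric])
qed

end

text \<open>The drift \<open>a * tanh (a * x)\<close> is even in \<open>a\<close>, so one and the same process can be tilted
  towards either sign.\<close>

lemma tanh_diffusion_uminus: "tanh_diffusion M F T W a x0 X \<Longrightarrow> tanh_diffusion M F T W (- a) x0 X"
  by (simp add: tanh_diffusion_def tanh_diffusion_axioms_def)

text \<open>The two posteriors add up to \<open>1\<close>, so undoing the two conditionings recovers the original
  measure as their mixture with the prior weights.\<close>

lemma (in tanh_diffusion) emeasure_mixture:
  assumes S[measurable]: "S \<in> sets M"
  shows "emeasure M S =
    ennreal (sign_posterior a x0) * emeasure tilted S +
    ennreal (1 - sign_posterior a x0) * emeasure (tanh_diffusion.tilted M T (- a) x0 X) S"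
proof -
  interpret m: tanh_diffusion M F T W "- a" x0 X
    by (rule tanh_diffusion_uminus) unfold_locales
  let ?e = "\<lambda>a. expectation (\<lambda>\<omega>. indicator S \<omega> * sign_posterior a (X T \<omega>))"
  have "?e a + ?e (- a) = expectation (\<lambda>\<omega>. indicator S \<omega> * sign_posterior a (X T \<omega>) + indicator S \<omega> * sign_posterior (- a) (X T \<omega>))"
    using posterior_weight_integrable[OF S] m.posterior_weight_integrable[OF S] by simp
  also have "\<dots> = expectation (indicator S)"
    by (intro Bochner_Integration.integral_cong) (auto simp: sign_posterior_uminus algebra_simps)
  finally have "emeasure M S = ennreal (?e a + ?e (- a))"
    by (simp add: emeasure_eq_measure)
  moreover have "0 \<le> ?e a'" for a'
    using sign_posterior_bounds(1)[of a'] by (intro integral_nonneg_AE) (auto simp: less_imp_le)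
  ultimately have "emeasure M S = ennreal (?e a) + ennreal (?e (- a))"
    by (simp add: ennreal_plus)
  then show ?thesis
    using emeasure_tilted_weighted[OF S] m.emeasure_tilted_weighted[OF S]
    by (simp add: sign_posterior_uminus)
qed

section \<open>Mixtures of drifted Brownian motions\<close>

lemma (in brownian) drifted_marginal:
  assumes t: "t \<in> {0<..T}"
  shows "distributed M lborel (\<lambda>\<omega>. \<beta> + W t \<omega>) (normal_density \<beta> (sqrt t))"
proof -
  have t0: "0 \<in> {0..T}" "t \<in> {0<..T}" "t \<in> {0..T}" using t by auto
  have [measurable]: "W 0 \<in> borel_measurable M" "W t \<in> borel_measurable M"
    using W_measurable t0 by auto
  have d: "distributed M lborel (\<lambda>\<omega>. \<beta> + 1 * (W t \<omega> - W 0 \<omega>)) (normal_density (\<beta> + 1 * 0) (\<bar>1\<bar> * sqrt (t - 0)))"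
    by (rule normal_density_affine[OF increment_distributed[OF t0(1,2)]]) (use t in auto)
  have "distr M lborel (\<lambda>\<omega>. \<beta> + W t \<omega>) = distr M lborel (\<lambda>\<omega>. \<beta> + 1 * (W t \<omega> - W 0 \<omega>))"
    by (rule distr_cong_AE) (use W_start in \<open>auto\<close>)
  then show ?thesis using d unfolding distributed_def by simp
qed

text \<open>The common description of the diffusion and of the process with a random sign. The two
  conditional measures are existential: they arise by tilting in one case and by conditioning on
  the sign in the other, and only the decomposition matters for laws of \<open>X\<close>.\<close>

definition drift_mixture ::
  "'a measure \<Rightarrow> real \<Rightarrow> real \<Rightarrow> real \<Rightarrow> real \<Rightarrow> (real \<Rightarrow> 'a \<Rightarrow> real) \<Rightarrow> bool" where
  "drift_mixture M T x0 c p X \<longleftrightarrow> (\<exists>M1 F1 W1 M2 F2 W2.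
     brownian M1 F1 T W1 \<and> brownian M2 F2 T W2 \<and> sets M1 = sets M \<and> sets M2 = sets M \<and>
     (AE \<omega> in M1. \<forall>t\<in>{0..T}. X t \<omega> = x0 + c * t + W1 t \<omega>) \<and>
     (AE \<omega> in M2. \<forall>t\<in>{0..T}. X t \<omega> = x0 + (- c) * t + W2 t \<omega>) \<and>
     (\<forall>S\<in>sets M. emeasure M S = ennreal p * emeasure M1 S + ennreal (1 - p) * emeasure M2 S))"

lemma cylinder_sets:
  assumes "finite J" "\<And>j. j \<in> J \<Longrightarrow> X j \<in> borel_measurable M" "\<And>j. j \<in> J \<Longrightarrow> A j \<in> sets borel"
  shows "{\<omega> \<in> space M. \<forall>j\<in>J. X j \<omega> \<in> A j} \<in> sets M"
  using assms by (intro sets.sets_Collect_finite_All) (auto intro!: measurable_sets_Collect)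

lemma brownian_cylinder:
  fixes A :: "real \<Rightarrow> real set"
  assumes M: "brownian M F T W"
    and AE: "AE \<omega> in M. \<forall>t\<in>{0..T}. X t \<omega> = x0 + c * t + W t \<omega>"
    and X: "\<And>t. t \<in> {0..T} \<Longrightarrow> X t \<in> borel_measurable M"
    and J: "finite J" "J \<subseteq> {0..T}" and A: "\<And>j. j \<in> J \<Longrightarrow> A j \<in> sets borel"
  defines "f \<equiv> (\<lambda>j y. if j \<in> J then indicator (A j) (x0 + c * j + y) else (1 :: ennreal))"
  shows "emeasure M {\<omega> \<in> space M. \<forall>j\<in>J. X j \<omega> \<in> A j} = (\<integral>\<^sup>+\<omega>. (\<Prod>j\<in>J. f j (W j \<omega>)) \<partial>M)"
proof -
  have S: "{\<omega> \<in> space M. \<forall>j\<in>J. X j \<omega> \<in> A j} \<in> sets M"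
    using J X A by (intro cylinder_sets) auto
  have "emeasure M {\<omega> \<in> space M. \<forall>j\<in>J. X j \<omega> \<in> A j} =
      (\<integral>\<^sup>+\<omega>. indicator {\<omega> \<in> space M. \<forall>j\<in>J. X j \<omega> \<in> A j} \<omega> \<partial>M)"
    using S by simp
  also have "\<dots> = (\<integral>\<^sup>+\<omega>. (\<Prod>j\<in>J. f j (W j \<omega>)) \<partial>M)"
  proof (rule nn_integral_cong_AE)
    show "AE \<omega> in M. indicator {\<omega> \<in> space M. \<forall>j\<in>J. X j \<omega> \<in> A j} \<omega> = (\<Prod>j\<in>J. f j (W j \<omega>))"
      using AE AE_space
    proof eventually_elim
      case (elim \<omega>)
      have "f j (W j \<omega>) = indicator (A j) (X j \<omega>)" if "j \<in> J" for j
        using that elim(1) J(2) by (auto simp: f_def)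
      then have "(\<Prod>j\<in>J. f j (W j \<omega>)) = (\<Prod>j\<in>J. indicator (A j) (X j \<omega>))"
        by (intro prod.cong) auto
      also have "\<dots> = indicator {\<omega> \<in> space M. \<forall>j\<in>J. X j \<omega> \<in> A j} \<omega>"
        using elim(2) J(1) by (auto simp: indicator_def)
      finally show ?case by simp
    qed
  qed
  finally show ?thesis .
qed

lemma drifted_brownian_fidi_unique:
  fixes A :: "real \<Rightarrow> real set"
  assumes M: "brownian M F T W" "AE \<omega> in M. \<forall>t\<in>{0..T}. X t \<omega> = x0 + c * t + W t \<omega>"
      "\<And>t. t \<in> {0..T} \<Longrightarrow> X t \<in> borel_measurable M"
    and N: "brownian N G T V" "AE \<omega> in N. \<forall>t\<in>{0..T}. Y t \<omega> = x0 + c * t + V t \<omega>"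
      "\<And>t. t \<in> {0..T} \<Longrightarrow> Y t \<in> borel_measurable N"
    and J: "finite J" "J \<subseteq> {0..T}" and A: "\<And>j. j \<in> J \<Longrightarrow> A j \<in> sets borel"
  shows "emeasure M {\<omega> \<in> space M. \<forall>j\<in>J. X j \<omega> \<in> A j} = emeasure N {\<omega> \<in> space N. \<forall>j\<in>J. Y j \<omega> \<in> A j}"
proof -
  let ?f = "\<lambda>j y. if j \<in> J then indicator (A j) (x0 + c * j + y) else (1 :: ennreal)"
  have f: "?f j \<in> borel_measurable borel" for j
    using A[of j] by (cases "j \<in> J") auto
  have "emeasure M {\<omega> \<in> space M. \<forall>j\<in>J. X j \<omega> \<in> A j} = (\<integral>\<^sup>+\<omega>. (\<Prod>j\<in>J. ?f j (W j \<omega>)) \<partial>M)"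
    by (rule brownian_cylinder) (fact M J A)+
  also have "\<dots> = (\<integral>\<^sup>+\<omega>. (\<Prod>j\<in>J. ?f j (V j \<omega>)) \<partial>N)"
    by (rule brownian_fidi_unique[OF M(1) N(1) J f])
  also have "\<dots> = emeasure N {\<omega> \<in> space N. \<forall>j\<in>J. Y j \<omega> \<in> A j}"
    by (rule sym, rule brownian_cylinder) (fact N J A)+
  finally show ?thesis .
qed

lemma path_law_cylinder:
  assumes X: "\<And>t. t \<in> {0..T} \<Longrightarrow> X t \<in> borel_measurable M"
    and J: "finite J" "J \<subseteq> {0..T}" and A: "\<And>j. j \<in> J \<Longrightarrow> A j \<in> sets borel"
  shows "emeasure (path_law M T X) (prod_emb {0..T} (\<lambda>_. borel) J (Pi\<^sub>E J A)) =
    emeasure M {\<omega> \<in> space M. \<forall>j\<in>J. X j \<omega> \<in> A j}"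
proof -
  have "(\<lambda>\<omega>. \<lambda>t\<in>{0..T}. X t \<omega>) \<in> measurable M (\<Pi>\<^sub>M t\<in>{0..T}. borel)"
    using X by (intro measurable_restrict) auto
  moreover have "prod_emb {0..T} (\<lambda>_. borel) J (Pi\<^sub>E J A) \<in> sets (\<Pi>\<^sub>M t\<in>{0..T}. borel)"
    using J A by (intro sets_PiM_I) auto
  moreover have "(\<lambda>\<omega>. \<lambda>t\<in>{0..T}. X t \<omega>) -` prod_emb {0..T} (\<lambda>_. borel) J (Pi\<^sub>E J A) \<inter> space M
      = {\<omega> \<in> space M. \<forall>j\<in>J. X j \<omega> \<in> A j}"
  proof -
    have "restrict (\<lambda>t\<in>{0..T}. X t \<omega>) J = restrict (\<lambda>t. X t \<omega>) J" for \<omega>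
      using J(2) by (auto simp: fun_eq_iff restrict_def)
    then show ?thesis by (auto simp: prod_emb_def restrict_PiE_iff)
  qed
  ultimately show ?thesis
    unfolding path_law_def by (simp add: emeasure_distr)
qed

text \<open>Cylinder events determine a law on path space, and on each of them both processes are the
  same mixture of probabilities of drifted Brownian motions.\<close>

lemma drift_mixture_path_law:
  assumes M: "drift_mixture M T x0 c p X" "\<And>t. t \<in> {0..T} \<Longrightarrow> X t \<in> borel_measurable M" "prob_space M"
    and N: "drift_mixture N T x0 c p Y" "\<And>t. t \<in> {0..T} \<Longrightarrow> Y t \<in> borel_measurable N"
  shows "path_law M T X = path_law N T Y"
proof -
  obtain M1 F1 W1 M2 F2 W2 where
    m: "brownian M1 F1 T W1" "brownian M2 F2 T W2" and sm: "sets M1 = sets M" "sets M2 = sets M"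
    and aem: "AE \<omega> in M1. \<forall>t\<in>{0..T}. X t \<omega> = x0 + c * t + W1 t \<omega>"
     "AE \<omega> in M2. \<forall>t\<in>{0..T}. X t \<omega> = x0 + (- c) * t + W2 t \<omega>"
    and mixm: "\<And>S. S \<in> sets M \<Longrightarrow> emeasure M S = ennreal p * emeasure M1 S + ennreal (1 - p) * emeasure M2 S"
    using M(1) unfolding drift_mixture_def by blast
  obtain N1 G1 V1 N2 G2 V2 where
    n: "brownian N1 G1 T V1" "brownian N2 G2 T V2" and sn: "sets N1 = sets N" "sets N2 = sets N"
    and aen: "AE \<omega> in N1. \<forall>t\<in>{0..T}. Y t \<omega> = x0 + c * t + V1 t \<omega>"
     "AE \<omega> in N2. \<forall>t\<in>{0..T}. Y t \<omega> = x0 + (- c) * t + V2 t \<omega>"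
    and mixn: "\<And>S. S \<in> sets N \<Longrightarrow> emeasure N S = ennreal p * emeasure N1 S + ennreal (1 - p) * emeasure N2 S"
    using N(1) unfolding drift_mixture_def by blast
  note sp = sets_eq_imp_space_eq[OF sm(1)] sets_eq_imp_space_eq[OF sm(2)]
    sets_eq_imp_space_eq[OF sn(1)] sets_eq_imp_space_eq[OF sn(2)]
  have X: "X t \<in> borel_measurable M1" "X t \<in> borel_measurable M2" if "t \<in> {0..T}" for t
    using M(2)[OF that] sm by (simp_all cong: measurable_cong_sets)
  have Y: "Y t \<in> borel_measurable N1" "Y t \<in> borel_measurable N2" if "t \<in> {0..T}" for t
    using N(2)[OF that] sn by (simp_all cong: measurable_cong_sets)
  show ?thesis
  proof (rule measure_eqI_PiM_infinite)
    show "sets (path_law M T X) = sets (\<Pi>\<^sub>M t\<in>{0..T}. borel)" "sets (path_law N T Y) = sets (\<Pi>\<^sub>M t\<in>{0..T}. borel)"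
      by (simp_all add: path_law_def)
    interpret prob_space M by (rule M(3))
    have "prob_space (path_law M T X)"
      unfolding path_law_def by (rule prob_space_distr) (use M(2) in \<open>intro measurable_restrict, auto\<close>)
    then show "finite_measure (path_law M T X)" by (rule prob_space.finite_measure)
    fix A :: "real \<Rightarrow> real set" and J :: "real set"
    assume J: "finite J" "J \<subseteq> {0..T}" and A: "\<And>i. i \<in> J \<Longrightarrow> A i \<in> sets borel"
    have SM: "{\<omega> \<in> space M. \<forall>j\<in>J. X j \<omega> \<in> A j} \<in> sets M"
      using J M(2) A by (intro cylinder_sets) auto
    have SN: "{\<omega> \<in> space N. \<forall>j\<in>J. Y j \<omega> \<in> A j} \<in> sets N"
      using J N(2) A by (intro cylinder_sets) auto
    have PM: "emeasure (path_law M T X) (prod_emb {0..T} (\<lambda>_. borel) J (Pi\<^sub>E J A))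
        = emeasure M {\<omega> \<in> space M. \<forall>j\<in>J. X j \<omega> \<in> A j}"
      by (rule path_law_cylinder) (fact M(2) J A)+
    have PN: "emeasure (path_law N T Y) (prod_emb {0..T} (\<lambda>_. borel) J (Pi\<^sub>E J A))
        = emeasure N {\<omega> \<in> space N. \<forall>j\<in>J. Y j \<omega> \<in> A j}"
      by (rule path_law_cylinder) (fact N(2) J A)+
    show "emeasure (path_law M T X) (prod_emb {0..T} (\<lambda>_. borel) J (Pi\<^sub>E J A)) =
      emeasure (path_law N T Y) (prod_emb {0..T} (\<lambda>_. borel) J (Pi\<^sub>E J A))"
      unfolding PM PN mixm[OF SM] mixn[OF SN]
      using drifted_brownian_fidi_unique[where A = A, OF m(1) aem(1) X(1) n(1) aen(1) Y(1) J A]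
        drifted_brownian_fidi_unique[where A = A, OF m(2) aem(2) X(2) n(2) aen(2) Y(2) J A]
      by (simp add: sp)
  qed
qed

lemma drift_mixture_marginal:
  assumes M: "drift_mixture M T x0 c p X" "X t \<in> borel_measurable M"
    and t: "t \<in> {0<..T}" and p: "0 \<le> p" "p \<le> 1"
  shows "distributed M lborel (X t)
    (\<lambda>x. p * normal_density (x0 + c * t) (sqrt t) x + (1 - p) * normal_density (x0 - c * t) (sqrt t) x)"
proof -
  obtain M1 F1 W1 M2 F2 W2 where
    m: "brownian M1 F1 T W1" "brownian M2 F2 T W2" and sm: "sets M1 = sets M" "sets M2 = sets M"
    and ae: "AE \<omega> in M1. \<forall>t\<in>{0..T}. X t \<omega> = x0 + c * t + W1 t \<omega>"
     "AE \<omega> in M2. \<forall>t\<in>{0..T}. X t \<omega> = x0 + (- c) * t + W2 t \<omega>"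
    and mix: "\<And>S. S \<in> sets M \<Longrightarrow> emeasure M S = ennreal p * emeasure M1 S + ennreal (1 - p) * emeasure M2 S"
    using M(1) unfolding drift_mixture_def by blast
  let ?n1 = "normal_density (x0 + c * t) (sqrt t)" and ?n2 = "normal_density (x0 - c * t) (sqrt t)"
  have law: "distr M' lborel (X t) = density lborel (normal_density (x0 + d * t) (sqrt t))"
    if b: "brownian M' F' T W'" and s: "sets M' = sets M"
      and a: "AE \<omega> in M'. \<forall>t\<in>{0..T}. X t \<omega> = x0 + d * t + W' t \<omega>" for M' F' W' d
  proof -
    have dist: "distributed M' lborel (\<lambda>\<omega>. x0 + d * t + W' t \<omega>) (normal_density (x0 + d * t) (sqrt t))"
      by (rule brownian.drifted_marginal[OF b t])
    have "distr M' lborel (X t) = distr M' lborel (\<lambda>\<omega>. x0 + d * t + W' t \<omega>)"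
    proof (rule distr_cong_AE)
      show "AE \<omega> in M'. X t \<omega> = x0 + d * t + W' t \<omega>"
        using a by eventually_elim (use t in auto)
      show "X t \<in> measurable M' lborel" using M(2) s by (simp cong: measurable_cong_sets)
      show "(\<lambda>\<omega>. x0 + d * t + W' t \<omega>) \<in> measurable M' lborel"
        by (rule distributed_measurable[OF dist])
    qed auto
    then show ?thesis using distributed_distr_eq_density[OF dist] by simp
  qed
  note l1 = law[OF m(1) sm(1) ae(1)] and l2 = law[OF m(2) sm(2) ae(2)]
  have "distr M lborel (X t) = density lborel (\<lambda>x. ennreal (p * ?n1 x + (1 - p) * ?n2 x))"
  proof (rule measure_eqI)
    fix A assume "A \<in> sets (distr M lborel (X t))"
    then have A[measurable]: "A \<in> sets borel" by simp
    have S: "X t -` A \<inter> space M \<in> sets M" using M(2) A by (rule measurable_sets)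
    have e: "emeasure M' (X t -` A \<inter> space M) = emeasure (distr M' lborel (X t)) A"
      if "sets M' = sets M" for M'
      using that M(2) sets_eq_imp_space_eq[OF that]
      by (subst emeasure_distr) (auto cong: measurable_cong_sets)
    have "emeasure (distr M lborel (X t)) A = ennreal p * emeasure (density lborel ?n1) A + ennreal (1 - p) * emeasure (density lborel ?n2) A"
      using mix[OF S] e[OF refl] e[OF sm(1)] e[OF sm(2)] by (simp add: l1 l2)
    also have "\<dots> = (\<integral>\<^sup>+x. ennreal p * (ennreal (?n1 x) * indicator A x) + ennreal (1 - p) * (ennreal (?n2 x) * indicator A x) \<partial>lborel)"
      by (simp add: emeasure_density nn_integral_add nn_integral_cmult)
    also have "\<dots> = (\<integral>\<^sup>+x. ennreal (p * ?n1 x + (1 - p) * ?n2 x) * indicator A x \<partial>lborel)"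
      using p by (intro nn_integral_cong) (auto simp: ennreal_mult ennreal_plus indicator_def)
    also have "\<dots> = emeasure (density lborel (\<lambda>x. ennreal (p * ?n1 x + (1 - p) * ?n2 x))) A"
      by (simp add: emeasure_density)
    finally show "emeasure (distr M lborel (X t)) A = emeasure (density lborel (\<lambda>x. ennreal (p * ?n1 x + (1 - p) * ?n2 x))) A" .
  qed simp
  then show ?thesis using M(2) by (simp add: distributed_def)
qed

lemma tanh_diffusion_drift_mixture:
  assumes "tanh_diffusion M F T W c x0 X"
  shows "drift_mixture M T x0 c (sign_posterior c x0) X"
proof -
  interpret P: tanh_diffusion M F T W c x0 X by fact
  interpret Q: tanh_diffusion M F T W "- c" x0 X by (rule tanh_diffusion_uminus) fact
  show ?thesis
    unfolding drift_mixture_def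
  proof (intro exI conjI ballI)
    show "brownian P.tilted F T P.driftless" by (rule P.brownian_tilted)
    show "brownian Q.tilted F T Q.driftless" by (rule Q.brownian_tilted)
    show "emeasure M S = ennreal (sign_posterior c x0) * emeasure P.tilted S +
        ennreal (1 - sign_posterior c x0) * emeasure Q.tilted S" if "S \<in> sets M" for S
      by (rule P.emeasure_mixture[OF that])
  qed (simp_all add: P.driftless_def Q.driftless_def)
qed

text \<open>The sign is known at time \<open>0\<close>, so conditioning on it leaves \<open>V\<close> a Brownian motion and makes
  the drift constant.\<close>

lemma bernoulli_drift_mixture:
  assumes sol: "bernoulli_drift_solution N G T x0 c p B V Y"
    and T: "0 \<le> T" and c: "0 < c" and p: "0 < p" "p < 1"
  shows "drift_mixture N T x0 c p Y"
proof -
  have BG: "B \<in> borel_measurable (G 0)"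
    and lawB: "distr N borel B = distr (measure_pmf (bernoulli_pmf p)) borel (\<lambda>h. if h then c else - c)"
    and sde: "sde_solution N G T x0 (\<lambda>_ \<omega>. B \<omega>) V Y"
    using sol by (auto simp: bernoulli_drift_solution_def)
  interpret brownian N G T V
    using sde T by unfold_locales (auto simp: sde_solution_def)
  have B[measurable]: "B \<in> borel_measurable N" using measurable_F_M[OF BG] T by auto
  let ?E = "\<lambda>e. B -` {e} \<inter> space N"
  have EG: "?E e \<in> sets (G 0)" for e
    using measurable_sets[OF BG, of "{e}"] space_F by simp
  have EN: "?E e \<in> sets N" for e
    using measurable_sets[OF B, of "{e}"] by simp
  have lawE: "prob (?E e) = measure (bernoulli_pmf p) ((\<lambda>h. if h then c else - c) -` {e})" for e
    using arg_cong[OF lawB, of "\<lambda>\<mu>. measure \<mu> {e}"] by (simp add: measure_distr)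
  have v: "(\<lambda>h. if h then c else - c) -` {c} = {True}" "(\<lambda>h. if h then c else - c) -` {- c} = {False}"
    using c by (auto split: if_splits)
  have Ec: "prob (?E c) = p" and Em: "prob (?E (- c)) = 1 - p"
    unfolding lawE v using p by (simp_all add: measure_pmf_single)
  have dr: "AE \<omega> in N. \<forall>t\<in>{0..T}. Y t \<omega> = x0 + B \<omega> * t + V t \<omega>"
  proof -
    have "AE \<omega> in N. \<forall>t\<in>{0..T}. ((\<lambda>s. B \<omega>) has_integral (Y t \<omega> - x0 - V t \<omega>)) {0..t}"
      using sde by (simp add: sde_solution_def)
    then show ?thesis
    proof (eventually_elim, intro ballI)
      fix \<omega> t assume a: "\<forall>t\<in>{0..T}. ((\<lambda>s. B \<omega>) has_integral (Y t \<omega> - x0 - V t \<omega>)) {0..t}"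
        and t: "t \<in> {0..T}"
      have "((\<lambda>s. B \<omega>) has_integral (Y t \<omega> - x0 - V t \<omega>)) {0..t}" using a t by blast
      moreover have "((\<lambda>s. B \<omega>) has_integral (B \<omega> * t)) {0..t}"
        using has_integral_const_real[of "B \<omega>" 0 t] t by (simp add: mult.commute)
      ultimately have "Y t \<omega> - x0 - V t \<omega> = B \<omega> * t" by (rule has_integral_unique)
      then show "Y t \<omega> = x0 + B \<omega> * t + V t \<omega>" by simp
    qed
  qed
  have cond: "AE \<omega> in uniform_measure N (?E e). \<forall>t\<in>{0..T}. Y t \<omega> = x0 + e * t + V t \<omega>"
    if "prob (?E e) \<noteq> 0" for e
  proof -
    have "AE \<omega> in N. \<omega> \<in> ?E e \<longrightarrow> (\<forall>t\<in>{0..T}. Y t \<omega> = x0 + e * t + V t \<omega>)"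
      using dr by eventually_elim auto
    then show ?thesis
      using that EN[of e] by (subst AE_uniform_measure) (auto simp: emeasure_eq_measure)
  qed
  show ?thesis
    unfolding drift_mixture_def
  proof (intro exI conjI ballI)
    show "brownian (uniform_measure N (?E c)) G T V" "brownian (uniform_measure N (?E (- c))) G T V"
      using brownian_uniform_measure[OF EG] Ec Em p by auto
    show "AE \<omega> in uniform_measure N (?E c). \<forall>t\<in>{0..T}. Y t \<omega> = x0 + c * t + V t \<omega>"
      "AE \<omega> in uniform_measure N (?E (- c)). \<forall>t\<in>{0..T}. Y t \<omega> = x0 + (- c) * t + V t \<omega>"
      by (rule cond; use Ec Em p in simp)+
    fix S assume S: "S \<in> sets N"
    have w: "ennreal (prob (?E e)) * emeasure (uniform_measure N (?E e)) S = ennreal (prob (?E e \<inter> S))"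
      if "prob (?E e) \<noteq> 0" for e
    proof -
      have pos: "0 < prob (?E e)" using that by (simp add: less_le)
      have "emeasure (uniform_measure N (?E e)) S = ennreal (prob (?E e \<inter> S) / prob (?E e))"
        using EN[of e] S pos by (simp add: emeasure_eq_measure divide_ennreal)
      then show ?thesis using pos by (simp add: ennreal_mult'[symmetric])
    qed
    \<comment> \<open>The two events \<open>B = \<plusminus>c\<close> are disjoint as \<open>c > 0\<close> and exhaust the space up to a null set.\<close>
    have disj: "?E c \<inter> ?E (- c) = {}" using c by auto
    have "prob (?E c \<union> ?E (- c)) = 1"
      using finite_measure_Union[OF EN EN disj] Ec Em by simp
    then have "prob S = prob (S \<inter> (?E c \<union> ?E (- c)))"
      using S EN prob_space by (intro measure_space_inter[symmetric]) auto
    also have "\<dots> = prob (?E c \<inter> S \<union> ?E (- c) \<inter> S)"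
      by (rule arg_cong[where f = prob]) auto
    also have "\<dots> = prob (?E c \<inter> S) + prob (?E (- c) \<inter> S)"
      using EN S disj by (intro finite_measure_Union) auto
    finally show "emeasure N S = ennreal p * emeasure (uniform_measure N (?E c)) S +
        ennreal (1 - p) * emeasure (uniform_measure N (?E (- c))) S"
      using w[of c] w[of "- c"] p unfolding Ec Em by (simp add: emeasure_eq_measure ennreal_plus)
  qed auto
qed

lemma Q_density_superposition:
  assumes "0 < t"
  shows "Q_density lam x0 t x =
    1 / 2 * normal_density (x0 + sqrt (2 * lam) * t) (sqrt t) x +
    1 / 2 * normal_density (x0 - sqrt (2 * lam) * t) (sqrt t) x"
  using assms
  by (simp add: Q_density_def normal_density_def algebra_simps add_divide_distrib)

theorem lemma2:
  fixes lam T x0 c p :: real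
    and M :: "'a measure" and F :: "real \<Rightarrow> 'a measure"
    and W X :: "real \<Rightarrow> 'a \<Rightarrow> real"
  defines "c \<equiv> sqrt (2 * lam)"
    and "p \<equiv> (1 + tanh (sqrt (2 * lam) * x0)) / 2"
  assumes "0 < lam" and "0 < T"
    and "sde_solution M F T x0 (\<lambda>x _. sqrt (2 * lam) * tanh (sqrt (2 * lam) * x)) W X"
  shows
    \<comment> \<open>for the start \<open>x0 = 0\<close>: the density \<open>Q\<close>, and the rewritten equation with a fair sign\<close>
    "(x0 = 0 \<longrightarrow>
        (\<forall>t\<in>{0<..T}. distributed M lborel (X t) (Q_density lam x0 t)) \<and>
        (\<forall>(N :: 'b measure) G B V Y.
           bernoulli_drift_solution N G T x0 c (1 / 2) B V Y \<longrightarrow> path_law M T X = path_law N T Y)) \<and>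
    \<comment> \<open>\<open>Q\<close> is the equal-weight superposition of the two drifted Wiener processes\<close>
     (\<forall>t\<in>{0<..T}.
        distributed M lborel (\<lambda>\<omega>. x0 + c * t + W t \<omega>) (normal_density (x0 + c * t) (sqrt t)) \<and>
        distributed M lborel (\<lambda>\<omega>. x0 - c * t + W t \<omega>) (normal_density (x0 - c * t) (sqrt t)) \<and>
        (\<forall>x. Q_density lam x0 t x =
           1 / 2 * normal_density (x0 + c * t) (sqrt t) x +
           1 / 2 * normal_density (x0 - c * t) (sqrt t) x)) \<and>
    \<comment> \<open>for an arbitrary start the two weights are \<open>p\<close> and \<open>1 - p\<close>, with \<open>p = 1 / 2\<close> iff \<open>x0 = 0\<close>\<close>
     (\<forall>t\<in>{0<..T}. distributed M lborel (X t)
        (\<lambda>x. p * normal_density (x0 + c * t) (sqrt t) x +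
             (1 - p) * normal_density (x0 - c * t) (sqrt t) x)) \<and>
     (\<forall>(N :: 'b measure) G B V Y.
        bernoulli_drift_solution N G T x0 c p B V Y \<longrightarrow> path_law M T X = path_law N T Y)"
proof -
  have c: "0 < c" using assms(3) by (simp add: c_def)
  have p: "p = sign_posterior c x0" by (simp add: p_def c_def sign_posterior_def)
  have p01: "0 < p" "p < 1" unfolding p by (rule sign_posterior_bounds)+
  interpret tanh_diffusion M F T W c x0 X
    using assms(4,5) by unfold_locales (auto simp: sde_solution_def c_def)
  have mix: "drift_mixture M T x0 c p X"
    unfolding p by (rule tanh_diffusion_drift_mixture) unfold_locales
  have marg: "distributed M lborel (X t)
      (\<lambda>x. p * normal_density (x0 + c * t) (sqrt t) x + (1 - p) * normal_density (x0 - c * t) (sqrt t) x)"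
    if "t \<in> {0<..T}" for t
    using that p01 X_measurable by (intro drift_mixture_marginal[OF mix]) auto
  have law: "path_law M T X = path_law N T Y"
    if sol: "bernoulli_drift_solution N G T x0 c p B V Y" for N :: "'b measure" and G B V Y
  proof (rule drift_mixture_path_law[OF mix X_measurable prob_space_axioms])
    show "drift_mixture N T x0 c p Y"
      by (rule bernoulli_drift_mixture[OF sol horizon_nonneg c p01])
    fix t assume t: "t \<in> {0..T}"
    interpret N: brownian N G T V
      using sol horizon_nonneg by unfold_locales (auto simp: bernoulli_drift_solution_def sde_solution_def)
    have "Y t \<in> borel_measurable (G t)"
      using sol t by (auto simp: bernoulli_drift_solution_def sde_solution_def)
    then show "Y t \<in> borel_measurable N" using t by (rule N.measurable_F_M)
  qed
  have half: "p = 1 / 2" if "x0 = 0" using that by (simp add: p_def)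
  have super: "Q_density lam x0 t x =
      1 / 2 * normal_density (x0 + c * t) (sqrt t) x + 1 / 2 * normal_density (x0 - c * t) (sqrt t) x"
    if "t \<in> {0<..T}" for t x
    using Q_density_superposition[of t lam x0 x] that by (simp add: c_def)
  have Q: "distributed M lborel (X t) (Q_density lam x0 t)" if "x0 = 0" "t \<in> {0<..T}" for t
    using marg[OF that(2)] super[OF that(2)] unfolding half[OF that(1)] by simp
  show ?thesis
  proof (intro conjI impI ballI allI)
    show "path_law M T X = path_law N T Y"
      if "x0 = 0" "bernoulli_drift_solution N G T x0 c (1 / 2) B V Y" for N :: "'b measure" and G B V Y
      using law that half by simp
  qed (fact Q super marg law drifted_marginal)+
qed

end
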